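(* Let $\mathcal{A}$ be a sufficiently generic arrangement of $n$ max-tropical hyperplanes in $\mathbb{T}^{d-1}$. For every $0\le i\le d-1$ the collection of coarse types $\mathbf{t}_{\mathcal{A}}(C)$ of the cells $C\in\mathcal{C}_{\mathcal{A}}$ with $\dim C=i$, counted with multiplicities, is independent of the arrangement (i.e. any two sufficiently generic arrangements of $n$ hyperplanes in $\mathbb{T}^{d-1}$ give the same multiset).
   Context: The tropical torus is $\mathbb{T}^{d-1}=\mathbb{R}^d/\mathbb{R}(1,\dots,1)\cong\mathbb{R}^{d-1}$. For $a\in\mathbb{T}^{d-1}$ the max-tropical hyperplane $H^{\max}(a)$ with apex $a$ has $k$-th closed sector $S_k^{\max}(a)=\{p\in\mathbb{T}^{d-1}: a_k-p_k\le a_j-p_j \text{ for all } j\in[d]\}$. For $V=(v_1,\dots,v_n)$ in $\mathbb{T}^{d-1}$, $\mathcal{A}(V)=(H^{\max}(v_1),\dots,H^{\max}(v_n))$. The fine type of $p$ is $T_{\mathcal{A}}(p)\in\{0,1\}^{n\times d}$ with $T_{\mathcal{A}}(p)_{ik}=1$ iff $p\in S_k^{\max}(v_i)$; the coarse type is $\mathbf{t}_{\mathcal{A}}(p)\in\mathbb{N}^d$, $\mathbf{t}_{\mathcal{A}}(p)_k=\sum_iT_{\mathcal{A}}(p)_{ik}$. The closures of the nonempty sets of points with fixed fine type are the cells of a polyhedral subdivision $\mathcal{C}_{\mathcal{A}}$ of $\mathbb{T}^{d-1}$; the coarse type of a cell is that of any point in its relative interior. The arrangement is sufficiently generic if the combinatorial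 type of $\mathcal{C}_{\mathcal{A}}$ is invariant under small perturbations of $V$; equivalently, the regular subdivision of $\Delta_{n-1}\times\Delta_{d-1}$ obtained by lifting the vertex $(e_i,e_j)$ to height $(v_i)_j$ and taking the lower convex hull is a triangulation. *)

theory Defs
  imports "HOL-Analysis.Analysis" "HOL-Library.Multiset"
begin

quotient_type (overloaded) 'd tropical_torus =
  "real ^ 'd" / "\<lambda>x y :: real ^ 'd::finite. \<exists>c::real. y = x + vec c"
proof (rule equivpI)
  show "reflp (\<lambda>x y :: real ^ 'd. \<exists>c::real. y = x + vec c)"
    by (rule reflpI, rule exI[of _ 0]) (simp add: vec_eq_iff)
  show "symp (\<lambda>x y :: real ^ 'd. \<exists>c::real. y = x + vec c)"
  proof (rule sympI)
    fix x y :: "real ^ 'd"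
    assume "\<exists>c::real. y = x + vec c"
    then obtain c :: real where "y = x + vec c" by blast
    then have "x = y + vec (- c)" by (simp add: vec_eq_iff)
    then show "\<exists>c::real. x = y + vec c" by blast
  qed
  show "transp (\<lambda>x y :: real ^ 'd. \<exists>c::real. y = x + vec c)"
  proof (rule transpI)
    fix x y z :: "real ^ 'd"
    assume "\<exists>c::real. y = x + vec c" "\<exists>c::real. z = y + vec c"
    then obtain c c' :: real where "y = x + vec c" "z = y + vec c'" by blast
    then have "z = x + vec (c + c')" by (simp add: vec_eq_iff)
    then show "\<exists>c::real. z = x + vec c" by blast
  qed
qed

abbreviation torus_proj :: "real ^ 'd::finite \<Rightarrow> 'd tropical_torus"
  where "torus_proj \<equiv> abs_tropical_torus"

instantiation tropical_torus :: (finite) topological_space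
begin

definition open_tropical_torus :: "'a tropical_torus set \<Rightarrow> bool"
  where "open_tropical_torus U \<longleftrightarrow> open (torus_proj -` U)"

instance
proof
  show "open (UNIV :: 'a tropical_torus set)"
    by (simp add: open_tropical_torus_def)
next
  fix S T :: "'a tropical_torus set"
  assume "open S" "open T"
  then show "open (S \<inter> T)"
    by (simp add: open_tropical_torus_def vimage_Int open_Int)
next
  fix K :: "'a tropical_torus set set"
  assume "\<forall>S\<in>K. open S"
  then show "open (\<Union>K)"
    by (simp add: open_tropical_torus_def vimage_Union open_UN)
qed

end

text \<open>
  Affine notions on the torus are those of the quotient vector space \<open>\<real>\<^sup>d / \<real>(1,\<dots>,1)\<close>.
  They are computed on the full preimage in \<open>\<real>\<^sup>d\<close>: the projection is linear, open and
  surjective with a one-dimensional kernel, so it maps the relative interior of the preimage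
  onto the relative interior, and the dimension of a nonempty set is one less than that of
  its preimage.
\<close>

definition torus_dim :: "'d::finite tropical_torus set \<Rightarrow> int"
  where "torus_dim C = aff_dim (torus_proj -` C) - 1"

definition torus_rel_interior :: "'d::finite tropical_torus set \<Rightarrow> 'd tropical_torus set"
  where "torus_rel_interior C = torus_proj ` rel_interior (torus_proj -` C)"

lift_definition in_sector :: "'d::finite \<Rightarrow> 'd tropical_torus \<Rightarrow> 'd tropical_torus \<Rightarrow> bool"
  is "\<lambda>k a p. \<forall>j. a $ k - p $ k \<le> a $ j - p $ j"
  by auto

definition max_sector :: "'d::finite \<Rightarrow> 'd tropical_torus \<Rightarrow> 'd tropical_torus set"
  where "max_sector k a = {p. in_sector k a p}"

lemma torus_proj_in_max_sector:
  "torus_proj p \<in> max_sector k (torus_proj a) \<longleftrightarrow> (\<forall>j. a $ k - p $ k \<le> a $ j - p $ j)"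
  by (simp add: max_sector_def in_sector.abs_eq)

text \<open>
  An arrangement of max-tropical hyperplanes is given by the tuple \<open>V\<close> of its apices,
  indexed by \<open>'n\<close>.
\<close>

definition fine_type ::
    "('d tropical_torus) ^ 'n \<Rightarrow> 'd::finite tropical_torus \<Rightarrow> nat ^ 'd ^ 'n::finite"
  where "fine_type V p = (\<chi> i k. if p \<in> max_sector k (V $ i) then 1 else 0)"

definition coarse_type ::
    "('d tropical_torus) ^ 'n::finite \<Rightarrow> 'd::finite tropical_torus \<Rightarrow> nat ^ 'd"
  where "coarse_type V p = (\<chi> k. \<Sum>i\<in>UNIV. fine_type V p $ i $ k)"

definition cells :: "('d::finite tropical_torus) ^ 'n::finite \<Rightarrow> 'd tropical_torus set set"
  where "cells V = {closure {p. fine_type V p = T} |T. {p. fine_type V p = T} \<noteq> {}}"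

definition cell_coarse_type ::
    "('d::finite tropical_torus) ^ 'n::finite \<Rightarrow> 'd tropical_torus set \<Rightarrow> nat ^ 'd"
  where "cell_coarse_type V C = (THE t. \<forall>p\<in>torus_rel_interior C. coarse_type V p = t)"

text \<open>
  The combinatorial type of a polyhedral complex is the isomorphism class of its face poset;
  in a complex, \<open>C\<close> is a face of \<open>D\<close> iff \<open>C \<subseteq> D\<close>.
\<close>

definition same_combinatorial_type ::
    "('d::finite tropical_torus) ^ 'n::finite \<Rightarrow> ('d tropical_torus) ^ 'n \<Rightarrow> bool"
  where "same_combinatorial_type V W \<longleftrightarrow>
    (\<exists>f. bij_betw f (cells V) (cells W) \<and>
         (\<forall>C\<in>cells V. \<forall>D\<in>cells V. C \<subseteq> D \<longleftrightarrow> f C \<subseteq> f D))"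

definition sufficiently_generic :: "('d::finite tropical_torus) ^ 'n::finite \<Rightarrow> bool"
  where "sufficiently_generic V \<longleftrightarrow> (\<forall>\<^sub>F W in nhds V. same_combinatorial_type V W)"

text \<open>
  Finiteness of the set of cells matters below, because \<^const>\<open>mset_set\<close> of an infinite set
  is empty.
\<close>

lemma finite_cells: "finite (cells V)"
  for V :: "('d::finite tropical_torus) ^ 'n::finite"
proof -
  have eq: "range (fine_type V) \<subseteq>
      (\<lambda>A. \<chi> i k. if (i, k) \<in> A then 1 else 0) ` (UNIV :: ('n \<times> 'd) set set)"
  proof
    fix T assume "T \<in> range (fine_type V)"
    then obtain p where "T = fine_type V p" by blast
    then have "T = (\<chi> i k. if (i, k) \<in> {(i, k). p \<in> max_sector k (V $ i)} then 1 else 0)"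
      by (simp add: fine_type_def)
    then show "T \<in> (\<lambda>A. \<chi> i k. if (i, k) \<in> A then 1 else 0) ` (UNIV :: ('n \<times> 'd) set set)"
      by blast
  qed
  have "finite (range (fine_type V))"
    by (rule finite_subset[OF eq]) simp
  moreover have "cells V \<subseteq> (\<lambda>T. closure {p. fine_type V p = T}) ` range (fine_type V)"
    by (auto simp: cells_def)
  ultimately show ?thesis by (meson finite_imageI finite_subset)
qed

definition coarse_types_of_dim ::
    "('d::finite tropical_torus) ^ 'n::finite \<Rightarrow> nat \<Rightarrow> (nat ^ 'd) multiset"
  where "coarse_types_of_dim V i =
    image_mset (cell_coarse_type V) (mset_set {C \<in> cells V. torus_dim C = int i})"

end

theory Submission
  imports Defs
begin

text \<open>
  Let \<open>n\<close> be the number of hyperplanes and \<open>d\<close> the number of coordinates. Consider the set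
  \<open>X u\<close> of points whose coarse type is at most \<open>u\<close> in every coordinate. It is open, since types
  can only shrink nearby, and closed under tropical combinations, since at a maximum of two
  points a row can only attain its minimum in a column where it did so at one of them. An
  open tropically convex set has the Euler characteristic of an open ball
  (\<open>euler_sum_tropically_convex\<close>): it projects to an open interval with fibres of the same
  kind. Hence the sum of \<open>(-1) ^ dim\<close> over the cells with coarse type at most \<open>u\<close> is, up to a
  fixed sign, 1 or 0 according to whether \<open>X u\<close> is nonempty.

  For a generic arrangement both ingredients are independent of the arrangement. All fine
  types, read as bipartite graphs between hyperplanes and coordinates, are forests, so the
  dimension of a cell is \<open>n + d - 1\<close> minus the number of edges, which is the sum of the
  coarse type (\<open>dim_direction_forest\<close>). And \<open>X u\<close> is nonempty iff the entries of \<open>u\<close> sum to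
  at least \<open>n\<close> (\<open>coarse_lower_set_nonempty_iff\<close>). The signed sums of the numbers of cells over
  all coarse types below \<open>u\<close> are thus known for every \<open>u\<close>, and they determine the numbers
  themselves by induction on \<open>u\<close> (\<open>type_number_generic_eq\<close>).

  It remains to see that stability of the face poset forces the forest property. A region
  of an arrangement certifies an assignment of hyperplanes to coordinates that is strictly
  optimal among those with the same fibre sizes, whereas a cycle in a fine type yields two
  assignments that tie for the optimum. So an arrangement has at most one region for each
  tuple of fibre sizes, and exactly one for each iff all fine types are forests
  (\<open>generic_iff_card_regions\<close>). Small perturbations reach this maximum, and the number of
  regions is the number of maximal cells (\<open>sufficiently_generic_imp_generic\<close>).
\<close>

section \<open>Euler characteristics of relatively open convex sets\<close>

text \<open>
  For relatively open convex sets this is the Euler characteristic with compact supports, the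
  version that is additive over disjoint unions.
\<close>

definition euler :: "'a::euclidean_space set \<Rightarrow> int"
  where "euler K = (if K = {} then 0 else (-1) ^ nat (aff_dim K))"

lemma euler_empty [simp]: "euler {} = 0"
  by (simp add: euler_def)

lemma euler_singleton [simp]: "euler {a} = 1"
  by (simp add: euler_def)

lemma euler_open:
  fixes K :: "'a::euclidean_space set"
  assumes "open K" "K \<noteq> {}"
  shows "euler K = (-1) ^ DIM('a)"
  using assms by (simp add: euler_def aff_dim_open)

lemma euler_square: "K \<noteq> {} \<Longrightarrow> euler K * euler K = 1"
  by (simp add: euler_def flip: power_add mult_2)

lemma rel_open_real_cases:
  fixes I :: "real set"
  assumes "rel_open I" "I \<noteq> {}"
  obtains a where "I = {a}" | "open I"
proof -
  have "0 \<le> aff_dim I"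
    using \<open>I \<noteq> {}\<close> aff_dim_negative_iff[of I] by linarith
  moreover have "aff_dim I \<le> 1"
    using aff_dim_le_DIM[of I] by simp
  ultimately consider "aff_dim I = 0" | "aff_dim I = 1"
    by linarith
  then show ?thesis
  proof cases
    case 1
    then show ?thesis
      using aff_dim_eq_0 that(1) by blast
  next
    case 2
    then have "affine hull I = UNIV"
      using aff_dim_eq_full[of I] by simp
    then have "rel_interior I = interior I"
      by (simp add: rel_interior_interior)
    then show ?thesis
      using assms(1) that(2) by (simp add: rel_open_def interior_eq)
  qed
qed

text \<open>
  Seen from the right, the indicator of an interval jumps only at its left end, and there the
  jump is the Euler characteristic: a point is lost at once, an open interval is entered.
\<close>

lemma eventually_jump:
  fixes I :: "real set"
  assumes "convex I" "rel_open I"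
  shows "\<forall>\<^sub>F e in at_right 0. (indicator I a - indicator I (a + e) :: int) =
    (if I \<noteq> {} \<and> bdd_below I \<and> Inf I = a then euler I else 0)"
proof (cases "I = {}")
  case True
  then show ?thesis by simp
next
  case False
  have interval: "y \<in> I" if "x \<in> I" "z \<in> I" "x \<le> y" "y \<le> z" for x y z
    using assms(1) that by (meson is_interval_1 is_interval_convex_1)
  have small: "\<forall>\<^sub>F e in at_right (0::real). 0 < e \<and> e < r" if "0 < r" for r
    using eventually_at_right_real[OF that] by simp
  from assms(2) False show ?thesis
  proof (cases rule: rel_open_real_cases)
    case (1 b)
    have "\<forall>\<^sub>F e in at_right (0::real). 0 < e \<and> e < (if a < b then b - a else 1)"
      by (rule small) simp
    then show ?thesis
      by eventually_elim (auto simp: 1 indicator_def split: if_splits)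
  next
    case 2
    have chi: "euler I = -1"
      using euler_open[OF 2 False] by simp
    show ?thesis
    proof (cases "a \<in> I")
      case True
      then obtain r where r: "0 < r" "ball a r \<subseteq> I"
        using 2 open_contains_ball by blast
      have ne: "Inf I \<noteq> a" if "bdd_below I"
      proof
        assume "Inf I = a"
        moreover have "a - r / 2 \<in> I"
          using r by (auto simp: dist_real_def)
        ultimately show False
          using cInf_lower[OF _ that, of "a - r / 2"] r(1) by simp
      qed
      have "\<forall>\<^sub>F e in at_right (0::real). 0 < e \<and> e < r"
        using r(1) by (rule small)
      then show ?thesis
      proof eventually_elim
        case (elim e)
        then have "a + e \<in> I"
          using r(2) by (auto simp: dist_real_def)
        with True ne show ?case by auto
      qed
    next
      case out: False
      show ?thesis
      proof (cases "bdd_below I \<and> Inf I = a")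
        case True
        obtain x where "x \<in> I" using False by blast
        with True out have x: "a < x"
          by (metis cInf_lower order_le_less)
        have "\<forall>\<^sub>F e in at_right (0::real). 0 < e \<and> e < x - a"
          using x by (intro small) simp
        then show ?thesis
        proof eventually_elim
          case (elim e)
          then have "Inf I < a + e" using True by simp
          then obtain z where "z \<in> I" "z < a + e"
            using False cInf_lessD by blast
          then have "a + e \<in> I"
            using interval[of z x "a + e"] \<open>x \<in> I\<close> elim by simp
          then show ?case using True False out chi by simp
        qed
      next
        case not_inf: False
        have "\<exists>r>0. \<forall>e. 0 < e \<and> e < r \<longrightarrow> a + e \<notin> I"
        proof (cases "\<exists>z\<in>I. z < a")
          case True
          then obtain z where "z \<in> I" "z < a" by blast
          then have "a + e \<notin> I" if "0 < e" for e
            using interval[of z "a + e" a] out that by auto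
          then show ?thesis
            by (intro exI[of _ 1]) simp
        next
          case False
          then have lb: "\<And>z. z \<in> I \<Longrightarrow> a \<le> z" by force
          then have "bdd_below I" by (auto simp: bdd_below_def)
          moreover have "a \<le> Inf I"
            using lb \<open>I \<noteq> {}\<close> by (intro cInf_greatest)
          ultimately have "a < Inf I" using not_inf by auto
          then show ?thesis
            using cInf_lower[OF _ \<open>bdd_below I\<close>] by (intro exI[of _ "Inf I - a"]) force
        qed
        then obtain r where r: "0 < r" "\<And>e. 0 < e \<and> e < r \<Longrightarrow> a + e \<notin> I" by blast
        have "\<forall>\<^sub>F e in at_right (0::real). 0 < e \<and> e < r"
          using r(1) by (rule small)
        then show ?thesis
          by eventually_elim (use r(2) out not_inf in auto)
      qed
    qed
  qed
qed

lemma eventually_at_bot_indicator: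
  fixes I :: "real set"
  assumes "convex I"
  shows "\<forall>\<^sub>F x in at_bot. (indicator I x :: int) = (if bdd_below I then 0 else 1)"
proof (cases "bdd_below I")
  case True
  then obtain m where "\<And>x. x \<in> I \<Longrightarrow> m \<le> x"
    by (auto simp: bdd_below_def)
  then have "indicator I x = (0::int)" if "x < m" for x
    using that by (force simp: indicator_def)
  then show ?thesis
    using True by (auto simp: eventually_at_bot_dense)
next
  case False
  then obtain x where x: "x \<in> I" by fastforce
  have "indicator I y = (1::int)" if "y \<le> x" for y
  proof -
    obtain z where "z \<in> I" "z < y"
      using False unfolding bdd_below_def by (meson not_le)
    then have "y \<in> I"
      using assms x that by (meson is_interval_1 is_interval_convex_1 less_imp_le)
    then show ?thesis by simp
  qed
  then show ?thesis
    using False unfolding eventually_at_bot_linorder by (intro exI[of _ x]) simp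
qed

text \<open>
  On finitely many intervals the Euler characteristic is therefore integration against one
  finite signed measure; the point \<open>M\<close> far to the left accounts for the intervals without
  a left end.
\<close>

lemma euler_real_as_finite_sum:
  fixes \<I> :: "real set set"
  assumes "finite \<I>" and \<I>: "\<And>I. I \<in> \<I> \<Longrightarrow> convex I \<and> rel_open I"
  shows "\<exists>L e M. finite L \<and>
    (\<forall>I\<in>\<I>. euler I = (\<Sum>a\<in>L. indicator I a - indicator I (a + e)) - indicator I M)"
proof -
  define L where "L = Inf ` \<I>"
  have "finite L" using assms(1) by (simp add: L_def)
  have "\<forall>\<^sub>F e in at_right 0. \<forall>I\<in>\<I>. \<forall>a\<in>L. (indicator I a - indicator I (a + e) :: int) =
      (if I \<noteq> {} \<and> bdd_below I \<and> Inf I = a then euler I else 0)"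
    using \<I> eventually_jump assms(1) \<open>finite L\<close> by (simp add: eventually_ball_finite_distrib)
  then obtain e where e: "\<And>I a. I \<in> \<I> \<Longrightarrow> a \<in> L \<Longrightarrow> (indicator I a - indicator I (a + e) :: int) =
      (if I \<noteq> {} \<and> bdd_below I \<and> Inf I = a then euler I else 0)"
    using eventually_happens'[OF trivial_limit_at_right_real] by blast
  have "\<forall>\<^sub>F x in at_bot. \<forall>I\<in>\<I>. (indicator I x :: int) = (if bdd_below I then 0 else 1)"
    using \<I> eventually_at_bot_indicator assms(1) by (simp add: eventually_ball_finite_distrib)
  then obtain M :: real where M: "\<And>I. I \<in> \<I> \<Longrightarrow> indicator I M = (if bdd_below I then 0 else 1 :: int)"
    using eventually_happens'[OF trivial_limit_at_bot_linorder] by blast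
  have "euler I = (\<Sum>a\<in>L. indicator I a - indicator I (a + e)) - indicator I M" if I: "I \<in> \<I>" for I
  proof -
    have "(\<Sum>a\<in>L. indicator I a - indicator I (a + e) :: int) =
        (\<Sum>a\<in>L. if a = Inf I then if I \<noteq> {} \<and> bdd_below I then euler I else 0 else 0)"
      using e[OF I] by (intro sum.cong) auto
    also have "\<dots> = (if I \<noteq> {} \<and> bdd_below I then euler I else 0)"
      using \<open>finite L\<close> I by (simp add: L_def)
    finally have sum: "(\<Sum>a\<in>L. indicator I a - indicator I (a + e) :: int) =
        (if I \<noteq> {} \<and> bdd_below I then euler I else 0)" .
    show ?thesis
    proof (cases "bdd_below I")
      case True
      then show ?thesis using sum M[OF I] by auto
    next
      case False
      then have "I \<noteq> {}" by auto
      have "euler I = -1"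
        using \<I>[OF I, THEN conjunct2] \<open>I \<noteq> {}\<close>
      proof (cases rule: rel_open_real_cases)
        case (1 a)
        then show ?thesis using False by simp
      next
        case 2
        then show ?thesis using euler_open[OF 2 \<open>I \<noteq> {}\<close>] by simp
      qed
      then show ?thesis using sum M[OF I] False by simp
    qed
  qed
  with \<open>finite L\<close> show ?thesis by blast
qed

text \<open>
  Additivity in dimension one; below it is applied to the projections to one coordinate.
\<close>

lemma euler_real_linear:
  fixes I :: "'j \<Rightarrow> real set" and b :: "'j \<Rightarrow> int"
  assumes "finite J" and I: "\<And>j. j \<in> J \<Longrightarrow> convex (I j) \<and> rel_open (I j)"
    and Y: "convex Y" "rel_open Y"
    and eq: "\<And>z. (\<Sum>j\<in>J. b j * indicator (I j) z) = c * indicator Y z"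
  shows "(\<Sum>j\<in>J. b j * euler (I j)) = c * euler Y"
proof -
  have "finite (insert Y (I ` J))" "\<And>K. K \<in> insert Y (I ` J) \<Longrightarrow> convex K \<and> rel_open K"
    using assms(1) I Y by auto
  from euler_real_as_finite_sum[OF this]
  obtain L e M where chi: "\<And>K. K \<in> insert Y (I ` J) \<Longrightarrow>
      euler K = (\<Sum>a\<in>L. indicator K a - indicator K (a + e)) - indicator K M"
    by blast
  define \<Phi> :: "(real \<Rightarrow> int) \<Rightarrow> int"
    where "\<Phi> f = (\<Sum>a\<in>L. f a - f (a + e)) - f M" for f
  have "(\<Sum>j\<in>J. b j * euler (I j)) = (\<Sum>j\<in>J. b j * \<Phi> (indicator (I j)))"
    using chi by (intro sum.cong) (auto simp: \<Phi>_def)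
  also have "\<dots> = \<Phi> (\<lambda>z. \<Sum>j\<in>J. b j * indicator (I j) z)"
    by (simp add: \<Phi>_def sum_distrib_left right_diff_distrib sum_subtractf
        sum.swap[of _ J L] del: sum_mult_indicator)
  also have "\<dots> = c * \<Phi> (indicator Y)"
    by (simp add: eq \<Phi>_def sum_distrib_left right_diff_distrib)
  also have "\<Phi> (indicator Y) = euler Y"
    using chi by (simp add: \<Phi>_def)
  finally show ?thesis .
qed

lemma hyperplane_component: "{p::real^'d::finite. p $ k = z} = {p. axis k 1 \<bullet> p = z}"
  by (simp add: inner_axis')

lemma convex_rel_open_slice:
  fixes K :: "(real^'d::finite) set"
  assumes "convex K" "rel_open K"
  shows "convex (K \<inter> {p. p $ k = z}) \<and> rel_open (K \<inter> {p. p $ k = z})"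
proof -
  have "affine {p::real^'d. p $ k = z}"
    unfolding hyperplane_component by (rule affine_hyperplane)
  then have "convex {p::real^'d. p $ k = z} \<and> rel_open {p::real^'d. p $ k = z}"
    by (simp add: affine_imp_convex affine_rel_open)
  then show ?thesis
    using convex_rel_open_finite_Inter[of "{K, {p. p $ k = z}}"] assms by auto
qed

lemma linear_component: "linear (\<lambda>p::real^'d::finite. p $ k)"
  by (simp add: linear_iff)

text \<open>
  Either the coordinate is constant on \<open>K\<close> and the slice is all of \<open>K\<close>, or the projection is
  an open interval and the hyperplane cuts the dimension by one.
\<close>

lemma euler_slice:
  fixes K :: "(real^'d::finite) set"
  assumes K: "convex K" "rel_open K" and z: "z \<in> (\<lambda>p. p $ k) ` K"
  shows "euler K = euler ((\<lambda>p. p $ k) ` K) * euler (K \<inter> {p. p $ k = z})"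
proof -
  let ?I = "(\<lambda>p. p $ k) ` K" and ?H = "{p::real^'d. p $ k = z}"
  have "K \<noteq> {}" "?I \<noteq> {}" using z by auto
  have "K \<inter> ?H \<noteq> {}" using z by auto
  have "rel_open ?I"
    using convex_rel_open_linear_image[OF linear_component K] by simp
  then show ?thesis using \<open>?I \<noteq> {}\<close>
  proof (cases rule: rel_open_real_cases)
    case (1 a)
    with z have "?I = {z}" by simp
    then have "K \<inter> ?H = K" by blast
    then show ?thesis using 1 by simp
  next
    case 2
    obtain U where U: "open U" "K = affine hull K \<inter> U"
      using K(2) by (auto simp: rel_open openin_open)
    have hyp: "?H = {p. axis k 1 \<bullet> p = z}" by (rule hyperplane_component)
    have aH: "affine (affine hull K \<inter> ?H)"
      unfolding hyp by (intro affine_Int affine_affine_hull affine_hyperplane)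
    have slice: "K \<inter> ?H = (affine hull K \<inter> ?H) \<inter> U"
      using U(2) by blast
    have "affine hull (K \<inter> ?H) = affine hull K \<inter> ?H"
      using affine_hull_affine_Int_open[OF aH U(1)] \<open>K \<inter> ?H \<noteq> {}\<close>
        affine_hull_eq[THEN iffD2, OF aH] unfolding slice by simp
    then have "aff_dim (K \<inter> ?H) = aff_dim (affine hull K \<inter> ?H)"
      by (metis aff_dim_affine_hull)
    moreover have "aff_dim (affine hull K \<inter> ?H) = aff_dim K - 1"
    proof -
      have "\<not> affine hull K \<subseteq> ?H"
      proof
        assume "affine hull K \<subseteq> ?H"
        then have "?I \<subseteq> {z}" using hull_subset[of K affine] by blast
        with 2 \<open>?I \<noteq> {}\<close> show False
          by (metis not_open_singleton subset_singleton_iff)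
      qed
      moreover have "affine hull K \<inter> ?H \<noteq> {}"
        using \<open>K \<inter> ?H \<noteq> {}\<close> hull_subset[of K affine] by blast
      ultimately show ?thesis
        using aff_dim_affine_Int_hyperplane[OF affine_affine_hull, of K "axis k 1" z]
        unfolding hyp by (simp add: aff_dim_affine_hull)
    qed
    ultimately have dim: "aff_dim (K \<inter> ?H) = aff_dim K - 1" by simp
    moreover have "0 \<le> aff_dim (K \<inter> ?H)"
      using \<open>K \<inter> ?H \<noteq> {}\<close> aff_dim_negative_iff[of "K \<inter> ?H"] by linarith
    ultimately have "nat (aff_dim K) = Suc (nat (aff_dim (K \<inter> ?H)))" by linarith
    then have "euler K = - euler (K \<inter> ?H)"
      using \<open>K \<noteq> {}\<close> \<open>K \<inter> ?H \<noteq> {}\<close> by (simp add: euler_def)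
    moreover have "euler ?I = -1"
      using euler_open[OF 2 \<open>?I \<noteq> {}\<close>] by simp
    ultimately show ?thesis by simp
  qed
qed

definition coordinate_flat :: "'d set \<Rightarrow> real^'d::finite \<Rightarrow> (real^'d) set"
  where "coordinate_flat S y = {p. \<forall>l. l \<notin> S \<longrightarrow> p $ l = y $ l}"

text \<open>
  On sets invariant under translation by \<open>(1,\<dots>,1)\<close> this is tropical convexity for the
  maximum. Only the translations of \<open>p\<close> by \<open>a \<ge> 0\<close> appear because, if the \<open>k\<close>-th
  coordinates of \<open>p\<close> and \<open>q\<close> agree, the new point has that \<open>k\<close>-th coordinate, too: the
  condition thus passes to hyperplanes on which one coordinate is fixed.
\<close>

definition tropically_convex :: "(real^'d::finite) set \<Rightarrow> bool"
  where "tropically_convex X \<longleftrightarrow>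
    (\<forall>p\<in>X. \<forall>q\<in>X. \<forall>a\<ge>0. (\<chi> l. max (p $ l - a) (q $ l)) \<in> X)"

lemma coordinate_flat_slice:
  assumes "k \<notin> S"
  shows "coordinate_flat (insert k S) y \<inter> {p. p $ k = z} =
    coordinate_flat S (\<chi> l. if l = k then z else y $ l)"
  using assms by (auto simp: coordinate_flat_def)

lemma tropically_convex_slice:
  assumes "tropically_convex X"
  shows "tropically_convex (X \<inter> {p. p $ k = z})"
  using assms by (auto simp: tropically_convex_def)

text \<open>
  Shifting \<open>p\<close> down moves the \<open>k\<close>-th coordinate of the maximum continuously from that of \<open>p\<close>
  to that of \<open>q\<close>, so no value in between is missed.
\<close>

lemma tropically_convex_projection:
  assumes "tropically_convex X"
  shows "convex ((\<lambda>p. p $ k) ` X)"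
proof -
  have "z \<in> (\<lambda>p. p $ k) ` X" if pq: "p \<in> X" "q \<in> X" "q $ k \<le> z" "z \<le> p $ k" for p q z
  proof -
    have "(\<chi> l. max (p $ l - (p $ k - z)) (q $ l)) \<in> X"
      using assms pq unfolding tropically_convex_def by simp
    moreover have "z = (\<chi> l. max (p $ l - (p $ k - z)) (q $ l)) $ k"
      using pq by simp
    ultimately show ?thesis by (rule rev_image_eqI)
  qed
  then show ?thesis
    unfolding is_interval_convex_1[symmetric] is_interval_1 by (auto elim!: imageE)
qed

lemma open_projection:
  assumes "open U" "k \<in> S"
  shows "open ((\<lambda>p::real^'d::finite. p $ k) ` (U \<inter> coordinate_flat S y))"
  unfolding open_dist
proof
  fix z assume "z \<in> (\<lambda>p. p $ k) ` (U \<inter> coordinate_flat S y)"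
  then obtain p where p: "p \<in> U" "p \<in> coordinate_flat S y" "z = p $ k" by blast
  obtain r where r: "0 < r" "ball p r \<subseteq> U"
    using assms(1) p(1) open_contains_ball by blast
  have "z' \<in> (\<lambda>p. p $ k) ` (U \<inter> coordinate_flat S y)" if "dist z' z < r" for z'
  proof -
    let ?q = "p + (z' - z) *\<^sub>R axis k 1"
    have "?q \<in> U"
      using r(2) that by (auto simp: dist_norm)
    moreover have "?q \<in> coordinate_flat S y"
      using p(2) assms(2) by (auto simp: coordinate_flat_def axis_def)
    moreover have "?q $ k = z'" using p(3) by (simp add: axis_def)
    ultimately show ?thesis by (metis (no_types, lifting) IntI image_eqI)
  qed
  with r(1) show "\<exists>e>0. \<forall>z'. dist z' z < e \<longrightarrow> z' \<in> (\<lambda>p. p $ k) ` (U \<inter> coordinate_flat S y)"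
    by blast
qed

text \<open>
  The proof is Fubini's theorem for the Euler characteristic, one free coordinate at a time:
  slices and projections of open tropically convex sets are again of this kind, and in
  dimension one such a set is an open interval.
\<close>

theorem euler_sum_tropically_convex:
  fixes K :: "'j \<Rightarrow> (real^'d::finite) set" and c :: "'j \<Rightarrow> int"
  assumes "finite J"
    and K: "\<And>j. j \<in> J \<Longrightarrow> convex (K j) \<and> rel_open (K j) \<and> K j \<subseteq> coordinate_flat S y"
    and "open U" "tropically_convex (U \<inter> coordinate_flat S y)"
    and cover: "\<And>p. (\<Sum>j\<in>J. c j * indicator (K j) p) = indicator (U \<inter> coordinate_flat S y) p"
  shows "(\<Sum>j\<in>J. c j * euler (K j)) = (if U \<inter> coordinate_flat S y = {} then 0 else (-1) ^ card S)"
  using finite[of S] K assms(4) cover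
proof (induction S arbitrary: y K rule: finite_induct)
  case empty
  have flat: "coordinate_flat {} y = {y}"
    by (auto simp: coordinate_flat_def vec_eq_iff)
  have "euler (K j) = indicator (K j) y" if "j \<in> J" for j
  proof -
    have "K j \<subseteq> {y}" using empty(1) that flat by auto
    then consider "K j = {}" | "K j = {y}" by blast
    then show ?thesis by cases auto
  qed
  then have "(\<Sum>j\<in>J. c j * euler (K j)) = (\<Sum>j\<in>J. c j * indicator (K j) y)"
    by simp
  also have "\<dots> = indicator (U \<inter> {y}) y"
    using empty(3) flat by simp
  finally show ?case by (auto simp: flat)
next
  case (insert k S)
  let ?X = "U \<inter> coordinate_flat (insert k S) y"
  let ?H = "\<lambda>z. {p::real^'d. p $ k = z}" and ?pr = "\<lambda>A. (\<lambda>p::real^'d. p $ k) ` A"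
  have slice: "(\<Sum>j\<in>J. c j * euler (K j \<inter> ?H z)) = (-1) ^ card S * indicator (?pr ?X) z" for z
  proof -
    let ?y = "\<chi> l. if l = k then z else y $ l"
    have flat: "coordinate_flat (insert k S) y \<inter> ?H z = coordinate_flat S ?y"
      using insert(2) by (rule coordinate_flat_slice)
    have X: "U \<inter> coordinate_flat S ?y = ?X \<inter> ?H z"
      using flat by blast
    have "(\<Sum>j\<in>J. c j * euler (K j \<inter> ?H z)) =
        (if U \<inter> coordinate_flat S ?y = {} then 0 else (-1) ^ card S)"
    proof (rule insert.IH)
      fix j assume j: "j \<in> J"
      show "convex (K j \<inter> ?H z) \<and> rel_open (K j \<inter> ?H z) \<and> K j \<inter> ?H z \<subseteq> coordinate_flat S ?y"
        using convex_rel_open_slice insert.prems(1)[OF j] flat by blast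
    next
      show "tropically_convex (U \<inter> coordinate_flat S ?y)"
        unfolding X by (intro tropically_convex_slice insert.prems(2))
    next
      fix p
      have "(\<Sum>j\<in>J. c j * indicator (K j \<inter> ?H z) p) =
          (\<Sum>j\<in>J. c j * indicator (K j) p) * indicator (?H z) p"
        by (simp add: indicator_inter_arith sum_distrib_right mult.assoc)
      also have "\<dots> = indicator ?X p * indicator (?H z) p"
        by (simp only: insert.prems(3))
      also have "\<dots> = indicator (U \<inter> coordinate_flat S ?y) p"
        by (simp only: X indicator_inter_arith)
      finally show "(\<Sum>j\<in>J. c j * indicator (K j \<inter> ?H z) p) = indicator (U \<inter> coordinate_flat S ?y) p" .
    qed
    moreover have "?X \<inter> ?H z = {} \<longleftrightarrow> z \<notin> ?pr ?X" by auto
    ultimately show ?thesis unfolding X by (simp add: indicator_def)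
  qed
  have prK: "convex (?pr (K j)) \<and> rel_open (?pr (K j))" if "j \<in> J" for j
    using convex_rel_open_linear_image[OF linear_component] insert.prems(1)[OF that] by blast
  have mult: "euler (K j \<inter> ?H z) = euler (K j) * euler (?pr (K j)) * indicator (?pr (K j)) z"
    if "j \<in> J" for j z
  proof (cases "z \<in> ?pr (K j)")
    case True
    then have "euler (?pr (K j)) * euler (?pr (K j)) = 1"
      by (intro euler_square) auto
    then show ?thesis
      using euler_slice[of "K j" z k] insert.prems(1)[OF that] True by (simp add: ac_simps)
  next
    case False
    then have "K j \<inter> ?H z = {}" by blast
    then show ?thesis using False by simp
  qed
  have "(\<Sum>j\<in>J. c j * euler (K j)) = (\<Sum>j\<in>J. (c j * euler (K j) * euler (?pr (K j))) * euler (?pr (K j)))"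
  proof (rule sum.cong)
    fix j assume "j \<in> J"
    show "c j * euler (K j) = (c j * euler (K j) * euler (?pr (K j))) * euler (?pr (K j))"
      using euler_square[of "?pr (K j)"] by (cases "K j = {}") (auto simp: mult.assoc)
  qed simp
  also have "\<dots> = (-1) ^ card S * euler (?pr ?X)"
  proof (rule euler_real_linear)
    show "finite J" by fact
    show "convex (?pr (K j)) \<and> rel_open (?pr (K j))" if "j \<in> J" for j
      using prK that .
    show "convex (?pr ?X)"
      by (rule tropically_convex_projection) (rule insert.prems(2))
    have "open (?pr ?X)"
      using \<open>open U\<close> by (intro open_projection) simp_all
    then show "rel_open (?pr ?X)"
      by (simp add: rel_open_def rel_interior_open)
    show "(\<Sum>j\<in>J. c j * euler (K j) * euler (?pr (K j)) * indicator (?pr (K j)) z) =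
        (-1) ^ card S * indicator (?pr ?X) z" for z
    proof -
      have "(\<Sum>j\<in>J. c j * euler (K j) * euler (?pr (K j)) * indicator (?pr (K j)) z) =
          (\<Sum>j\<in>J. c j * euler (K j \<inter> ?H z))"
        by (intro sum.cong refl) (simp only: mult mult.assoc)
      then show ?thesis by (simp only: slice)
    qed
  qed
  also have "\<dots> = (if ?X = {} then 0 else (-1) ^ card (insert k S))"
  proof -
    have "open (?pr ?X)"
      using \<open>open U\<close> by (intro open_projection) simp_all
    then show ?thesis
      using euler_open[of "?pr ?X"] insert(1,2) by auto
  qed
  finally show ?case .
qed

section \<open>Types of points and their cells\<close>

text \<open>
  Fine types are computed on representatives: \<open>v $ i\<close> represents the \<open>i\<close>-th apex and \<open>p\<close> a
  point, and the pairs \<open>(i, k)\<close> are the positions of the ones in the fine type of \<open>p\<close>. Read as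
  a bipartite graph, the row \<open>i\<close> is joined to the columns in which \<open>v $ i $ k - p $ k\<close> is least.
\<close>

definition type_at :: "real^'d^'n \<Rightarrow> real^'d \<Rightarrow> ('n::finite \<times> 'd::finite) set"
  where "type_at v p = {(i, k). \<forall>j. v $ i $ k - p $ k \<le> v $ i $ j - p $ j}"

definition open_cell :: "real^'d^'n \<Rightarrow> ('n::finite \<times> 'd::finite) set \<Rightarrow> (real^'d) set"
  where "open_cell v T = {p. type_at v p = T}"

text \<open>
  The coarse type, as a function of the column.
\<close>

definition column_count :: "('n::finite \<times> 'd) set \<Rightarrow> 'd \<Rightarrow> nat"
  where "column_count T k = card {i. (i, k) \<in> T}"

text \<open>
  The linear space parallel to the cells of type \<open>T\<close>.
\<close>

definition direction :: "('n \<times> 'd) set \<Rightarrow> (real^'d::finite) set"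
  where "direction T = {x. \<forall>i j k. (i, j) \<in> T \<longrightarrow> (i, k) \<in> T \<longrightarrow> x $ j = x $ k}"

lemma type_at_row_nonempty: "\<exists>k. (i, k) \<in> type_at v p"
proof -
  obtain k where "\<And>j. v $ i $ k - p $ k \<le> v $ i $ j - p $ j"
    using ex_min_if_finite[of "range (\<lambda>j. v $ i $ j - p $ j)"]
    by (auto simp: not_less)
  then show ?thesis by (auto simp: type_at_def)
qed

lemma type_at_mem_iff:
  assumes "(i, k) \<in> type_at v p"
  shows "(i, j) \<in> type_at v p \<longleftrightarrow> v $ i $ j - p $ j = v $ i $ k - p $ k"
proof
  assume "(i, j) \<in> type_at v p"
  with assms show "v $ i $ j - p $ j = v $ i $ k - p $ k"
    unfolding type_at_def by (simp add: order.antisym)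
next
  assume "v $ i $ j - p $ j = v $ i $ k - p $ k"
  with assms show "(i, j) \<in> type_at v p"
    unfolding type_at_def by simp
qed

lemma open_type_at_subset:
  fixes v :: "real^'d::finite^'n::finite"
  shows "open {p. type_at v p \<subseteq> T}"
proof -
  have "{p. type_at v p \<subseteq> T} = (\<Inter>s\<in>- T. {p. s \<notin> type_at v p})"
    by blast
  moreover have "open {p. s \<notin> type_at v p}" for s
  proof (cases s)
    case (Pair i k)
    have "{p. s \<notin> type_at v p} = (\<Union>j. {p. v $ i $ j - p $ j < v $ i $ k - p $ k})"
      by (auto simp: Pair type_at_def not_le)
    moreover have "open {p::real^'d. v $ i $ j - p $ j < v $ i $ k - p $ k}" for j
      by (intro open_Collect_less continuous_intros)
    ultimately show ?thesis by (simp add: open_UN)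
  qed
  ultimately show ?thesis by (simp add: open_INT)
qed

lemma eventually_type_at_subset: "\<forall>\<^sub>F q in nhds p. type_at v q \<subseteq> type_at v p"
  using eventually_nhds open_type_at_subset[of v "type_at v p"] by blast

lemma type_at_max:
  assumes "(i, k) \<in> type_at v (\<chi> l. max (p $ l - a) (q $ l))"
  shows "q $ k \<le> p $ k - a \<Longrightarrow> (i, k) \<in> type_at v p"
    and "p $ k - a \<le> q $ k \<Longrightarrow> (i, k) \<in> type_at v q"
proof -
  have le: "v $ i $ k - max (p $ k - a) (q $ k) \<le> v $ i $ j - max (p $ j - a) (q $ j)" for j
    using assms by (simp add: type_at_def)
  show "(i, k) \<in> type_at v p" if "q $ k \<le> p $ k - a"
    unfolding type_at_def
  proof (clarsimp)
    fix j
    show "v $ i $ k - p $ k \<le> v $ i $ j - p $ j"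
      using le[of j] that by linarith
  qed
  show "(i, k) \<in> type_at v q" if "p $ k - a \<le> q $ k"
    unfolding type_at_def
  proof (clarsimp)
    fix j
    show "v $ i $ k - q $ k \<le> v $ i $ j - q $ j"
      using le[of j] that by linarith
  qed
qed

lemma column_count_mono: "S \<subseteq> T \<Longrightarrow> column_count S k \<le> column_count T k"
  unfolding column_count_def by (intro card_mono) auto

lemma sum_column_count: "(\<Sum>k\<in>UNIV. column_count T k) = card (T :: ('n::finite \<times> 'd::finite) set)"
proof -
  have "card T = card (SIGMA k:UNIV. {i. (i, k) \<in> T})"
    by (rule bij_betw_same_card[of prod.swap], rule bij_betw_byWitness[where f' = prod.swap]) auto
  then show ?thesis by (simp add: column_count_def)
qed

lemma CARD_le_card_type_at: "CARD('n) \<le> card (type_at v p)"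
  for v :: "real^'d::finite^'n::finite"
proof -
  have "fst ` type_at v p = UNIV"
    using type_at_row_nonempty by (force simp: image_iff)
  then show ?thesis
    by (metis card_image_le finite)
qed

text \<open>
  In a maximum of two points each coordinate comes from one of them, and then a row that
  attains its minimum there already did so at that point.
\<close>

lemma column_count_type_at_max:
  "column_count (type_at v (\<chi> l. max (p $ l - a) (q $ l))) k
    \<le> max (column_count (type_at v p) k) (column_count (type_at v q) k)"
proof (cases "q $ k \<le> p $ k - a")
  case True
  then have "column_count (type_at v (\<chi> l. max (p $ l - a) (q $ l))) k \<le> column_count (type_at v p) k"
    unfolding column_count_def by (intro card_mono) (auto dest: type_at_max(1))
  then show ?thesis by simp
next
  case False
  then have "column_count (type_at v (\<chi> l. max (p $ l - a) (q $ l))) k \<le> column_count (type_at v q) k"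
    unfolding column_count_def by (intro card_mono) (auto dest: type_at_max(2))
  then show ?thesis by simp
qed

definition coarse_lower_set :: "real^'d^'n::finite \<Rightarrow> ('d \<Rightarrow> nat) \<Rightarrow> (real^'d::finite) set"
  where "coarse_lower_set v u = {p. column_count (type_at v p) \<le> u}"

lemma tropically_convex_coarse_lower_set: "tropically_convex (coarse_lower_set v u)"
  unfolding tropically_convex_def coarse_lower_set_def le_fun_def
  by (auto intro!: order.trans[OF column_count_type_at_max])

lemma open_coarse_lower_set: "open (coarse_lower_set v u)"
proof -
  have eq: "coarse_lower_set v u = (\<Union>T\<in>{T. column_count T \<le> u}. {p. type_at v p \<subseteq> T})"
    unfolding coarse_lower_set_def
    by (auto simp: le_fun_def intro: order.trans[OF column_count_mono])
  show ?thesis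
    unfolding eq by (intro open_UN ballI open_type_at_subset)
qed

lemma subspace_direction: "subspace (direction T)"
proof (rule subspaceI)
  show "x + y \<in> direction T" if x: "x \<in> direction T" and y: "y \<in> direction T" for x y
    unfolding direction_def
  proof (clarify)
    fix i j k assume "(i, j) \<in> T" "(i, k) \<in> T"
    then have "x $ j = x $ k" "y $ j = y $ k"
      using x y unfolding direction_def by blast+
    then show "(x + y) $ j = (x + y) $ k" by simp
  qed
  show "c *\<^sub>R x \<in> direction T" if x: "x \<in> direction T" for c x
    unfolding direction_def
  proof (clarify)
    fix i j k assume "(i, j) \<in> T" "(i, k) \<in> T"
    then have "x $ j = x $ k"
      using x unfolding direction_def by blast
    then show "(c *\<^sub>R x) $ j = (c *\<^sub>R x) $ k" by simp
  qed
qed (simp add: direction_def)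

text \<open>
  Once no new edges may appear, keeping the old ones takes only linear equations: this exhibits
  a cell as an open piece of a translate of its direction space.
\<close>

lemma open_cell_type_at:
  "open_cell v (type_at v p) = (+) p ` direction (type_at v p) \<inter> {q. type_at v q \<subseteq> type_at v p}"
proof (intro equalityI subsetI)
  fix q assume q: "q \<in> open_cell v (type_at v p)"
  then have eq: "type_at v q = type_at v p"
    by (simp add: open_cell_def)
  have "q - p \<in> direction (type_at v p)"
    unfolding direction_def
  proof (clarsimp)
    fix i j k assume jk: "(i, j) \<in> type_at v p" "(i, k) \<in> type_at v p"
    have "v $ i $ k - p $ k = v $ i $ j - p $ j"
      using type_at_mem_iff[OF jk(1)] jk(2) by blast
    moreover have "v $ i $ k - q $ k = v $ i $ j - q $ j"
      using type_at_mem_iff[of i j v q k] jk eq by blast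
    ultimately show "q $ j - p $ j = q $ k - p $ k" by linarith
  qed
  then have "q \<in> (+) p ` direction (type_at v p)"
    by (intro image_eqI[of _ _ "q - p"]) auto
  then show "q \<in> (+) p ` direction (type_at v p) \<inter> {q. type_at v q \<subseteq> type_at v p}"
    using eq by simp
next
  fix q assume "q \<in> (+) p ` direction (type_at v p) \<inter> {q. type_at v q \<subseteq> type_at v p}"
  then obtain x where x: "x \<in> direction (type_at v p)" "q = p + x"
    and sub: "type_at v q \<subseteq> type_at v p"
    by blast
  have "(i, j) \<in> type_at v q" if j: "(i, j) \<in> type_at v p" for i j
  proof -
    obtain k where k: "(i, k) \<in> type_at v q"
      using type_at_row_nonempty by blast
    with sub have kp: "(i, k) \<in> type_at v p" by blast
    have "x $ j = x $ k"
      using x(1) j kp unfolding direction_def by blast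
    moreover have "v $ i $ j - p $ j = v $ i $ k - p $ k"
      using type_at_mem_iff[OF kp] j by blast
    ultimately show ?thesis
      using type_at_mem_iff[OF k] x(2) by simp
  qed
  with sub show "q \<in> open_cell v (type_at v p)"
    by (auto simp: open_cell_def)
qed

text \<open>
  Moving from a point of the closed cell towards a point of the open cell, one enters the open
  cell at once. This gives convexity and, later, the closure of a cell.
\<close>

lemma type_at_segment:
  assumes "type_at v p \<subseteq> type_at v q" "0 < s" "s \<le> 1"
  shows "type_at v ((1 - s) *\<^sub>R q + s *\<^sub>R p) = type_at v p"
proof -
  let ?r = "(1 - s) *\<^sub>R q + s *\<^sub>R p"
  have comb: "v $ i $ j - ?r $ j = (1 - s) * (v $ i $ j - q $ j) + s * (v $ i $ j - p $ j)" for i j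
    by (simp add: algebra_simps)
  have sub: "type_at v p \<subseteq> type_at v ?r"
  proof (clarify)
    fix i k assume k: "(i, k) \<in> type_at v p"
    then have "(i, k) \<in> type_at v q" using assms(1) by blast
    with k have "v $ i $ k - ?r $ k \<le> v $ i $ j - ?r $ j" for j
      unfolding comb using assms(2,3)
      by (intro add_mono mult_left_mono) (auto simp: type_at_def)
    then show "(i, k) \<in> type_at v ?r" by (simp add: type_at_def)
  qed
  moreover have "(i, k) \<in> type_at v p" if k: "(i, k) \<in> type_at v ?r" for i k
  proof -
    obtain j where j: "(i, j) \<in> type_at v p"
      using type_at_row_nonempty by blast
    then have jq: "(i, j) \<in> type_at v q" using assms(1) by blast
    have "(i, j) \<in> type_at v ?r" using sub j by blast
    then have "v $ i $ k - ?r $ k = v $ i $ j - ?r $ j"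
      using type_at_mem_iff k by blast
    then have eq: "(1 - s) * (v $ i $ k - q $ k) + s * (v $ i $ k - p $ k) =
        (1 - s) * (v $ i $ j - q $ j) + s * (v $ i $ j - p $ j)"
      unfolding comb .
    have "(1 - s) * (v $ i $ j - q $ j) \<le> (1 - s) * (v $ i $ k - q $ k)"
      using jq assms(3) by (intro mult_left_mono) (auto simp: type_at_def)
    with eq have "s * (v $ i $ k - p $ k) \<le> s * (v $ i $ j - p $ j)" by linarith
    then have le: "v $ i $ k - p $ k \<le> v $ i $ j - p $ j"
      using assms(2) by simp
    show ?thesis
      unfolding type_at_def
    proof (clarsimp)
      fix l
      have "v $ i $ j - p $ j \<le> v $ i $ l - p $ l"
        using j by (simp add: type_at_def)
      with le show "v $ i $ k - p $ k \<le> v $ i $ l - p $ l" by linarith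
    qed
  qed
  ultimately show ?thesis by auto
qed

lemma convex_open_cell: "convex (open_cell v T)"
  unfolding convex_alt
proof (intro ballI allI impI)
  fix q p and s :: real
  assume q: "q \<in> open_cell v T" and p: "p \<in> open_cell v T" and s: "0 \<le> s \<and> s \<le> 1"
  show "(1 - s) *\<^sub>R q + s *\<^sub>R p \<in> open_cell v T"
  proof (cases "s = 0")
    case True
    then show ?thesis using q by simp
  next
    case False
    then show ?thesis
      using type_at_segment[of v p q s] q p s by (simp add: open_cell_def)
  qed
qed

lemma affine_translated_direction: "affine ((+) p ` direction T)"
  using affine_translation subspace_imp_affine[OF subspace_direction] by blast

lemma affine_hull_open_cell:
  "affine hull open_cell v (type_at v p) = (+) p ` direction (type_at v p)"
proof -
  let ?A = "(+) p ` direction (type_at v p)" and ?U = "{q. type_at v q \<subseteq> type_at v p}"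
  have "p \<in> open_cell v (type_at v p)" by (simp add: open_cell_def)
  then have "?A \<inter> ?U \<noteq> {}"
    unfolding open_cell_type_at by blast
  then have "affine hull (?A \<inter> ?U) = affine hull ?A"
    using affine_hull_affine_Int_open[OF affine_translated_direction open_type_at_subset] by blast
  also have "\<dots> = ?A"
    unfolding affine_hull_eq by (rule affine_translated_direction)
  finally show ?thesis
    by (simp only: open_cell_type_at)
qed

lemma rel_open_open_cell: "rel_open (open_cell v T)"
proof (cases "T \<in> range (type_at v)")
  case True
  then obtain p where T: "T = type_at v p" by blast
  have "openin (top_of_set (affine hull open_cell v T)) (open_cell v T)"
    unfolding T affine_hull_open_cell
    by (subst open_cell_type_at) (intro openin_open_Int open_type_at_subset)
  then show ?thesis by (simp add: rel_open)
next
  case False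
  then have "open_cell v T = {}" by (auto simp: open_cell_def)
  then show ?thesis by (simp add: rel_open_def)
qed

lemma aff_dim_open_cell:
  "aff_dim (open_cell v (type_at v p)) = int (dim (direction (type_at v p)))"
proof -
  have "aff_dim (open_cell v (type_at v p)) = aff_dim ((+) p ` direction (type_at v p))"
    by (metis aff_dim_affine_hull affine_hull_open_cell)
  also have "\<dots> = aff_dim (direction (type_at v p))"
    by (rule aff_dim_translation_eq)
  also have "\<dots> = int (dim (direction (type_at v p)))"
    by (rule aff_dim_subspace) (rule subspace_direction)
  finally show ?thesis .
qed

lemma one_in_direction: "vec 1 \<in> direction T"
  by (simp add: direction_def)

lemma dim_direction_pos: "0 < dim (direction T :: (real^'d::finite) set)"
proof -
  have "vec 1 \<noteq> (0 :: real^'d)" by (simp add: vec_eq_iff)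
  then have "\<not> direction T \<subseteq> {0 :: real^'d}"
    using one_in_direction by blast
  then show ?thesis by (simp add: dim_eq_0 flip: neq0_conv)
qed

text \<open>
  The points of coarse type at most \<open>u\<close> form an open tropically convex set, which the open
  cells partition.
\<close>

theorem euler_sum_coarse_lower_set:
  "(\<Sum>T | T \<in> range (type_at v) \<and> column_count T \<le> u. euler (open_cell v T)) =
    (if coarse_lower_set v u = {} then 0 else (-1) ^ CARD('d))"
  for v :: "real^'d::finite^'n::finite"
proof -
  let ?J = "{T. T \<in> range (type_at v) \<and> column_count T \<le> u}"
  have flat: "coordinate_flat UNIV y = UNIV" for y :: "real^'d"
    by (simp add: coordinate_flat_def)
  have cover: "(\<Sum>T\<in>?J. 1 * indicator (open_cell v T) p) =
      (indicator (coarse_lower_set v u \<inter> coordinate_flat UNIV 0) p :: int)" for p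
  proof -
    have "(\<Sum>T\<in>?J. 1 * indicator (open_cell v T) p) =
        (\<Sum>T\<in>?J. if T = type_at v p then 1 else 0 :: int)"
      by (intro sum.cong) (auto simp: open_cell_def indicator_def)
    also have "\<dots> = indicator (coarse_lower_set v u \<inter> coordinate_flat UNIV 0) p"
      by (simp add: flat coarse_lower_set_def indicator_def)
    finally show ?thesis .
  qed
  have "(\<Sum>T\<in>?J. 1 * euler (open_cell v T)) =
      (if coarse_lower_set v u \<inter> coordinate_flat UNIV 0 = {} then 0 else (-1) ^ CARD('d))"
    by (rule euler_sum_tropically_convex)
      (use cover in \<open>simp_all add: flat convex_open_cell rel_open_open_cell open_coarse_lower_set
        tropically_convex_coarse_lower_set\<close>)
  then show ?thesis by (simp add: flat)
qed

section \<open>Types of generic arrangements are forests\<close>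

text \<open>
  A type, read as a bipartite graph between rows and columns, is a forest iff no nonzero
  real weighting of its edges is balanced at every vertex.
\<close>

definition forest :: "('n::finite \<times> 'd::finite) set \<Rightarrow> bool"
  where "forest T \<longleftrightarrow> (\<forall>w::'n \<Rightarrow> 'd \<Rightarrow> real.
    (\<forall>i k. (i, k) \<notin> T \<longrightarrow> w i k = 0) \<longrightarrow> (\<forall>i. (\<Sum>k\<in>UNIV. w i k) = 0) \<longrightarrow>
    (\<forall>k. (\<Sum>i\<in>UNIV. w i k) = 0) \<longrightarrow> (\<forall>i k. w i k = 0))"

lemma forestD:
  fixes w :: "'n::finite \<Rightarrow> 'd::finite \<Rightarrow> real"
  assumes "forest T" "\<And>i k. (i, k) \<notin> T \<Longrightarrow> w i k = 0"
    "\<And>i. (\<Sum>k\<in>UNIV. w i k) = 0" "\<And>k. (\<Sum>i\<in>UNIV. w i k) = 0"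
  shows "w i k = 0"
  using assms unfolding forest_def by blast

definition graph :: "('n \<Rightarrow> 'd) \<Rightarrow> ('n \<times> 'd) set"
  where "graph f = {(i, f i) | i. True}"

lemma mem_graph_iff [simp]: "(i, k) \<in> graph f \<longleftrightarrow> k = f i"
  by (auto simp: graph_def)

lemma graph_subset_iff: "graph f \<subseteq> T \<longleftrightarrow> (\<forall>i. (i, f i) \<in> T)"
  by (auto simp: graph_def)

lemma graph_inject [simp]: "graph f = graph g \<longleftrightarrow> f = g"
  by (auto simp: set_eq_iff fun_eq_iff)

lemma card_graph [simp]: "card (graph f) = CARD('n)" for f :: "'n::finite \<Rightarrow> 'd"
proof -
  have "graph f = (\<lambda>i. (i, f i)) ` UNIV" by (auto simp: graph_def)
  then show ?thesis by (simp add: card_image inj_on_def)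
qed

lemma obtain_graph:
  assumes "\<And>i. \<exists>k. (i, k) \<in> T"
  obtains c where "graph c \<subseteq> T"
  using assms unfolding graph_subset_iff by metis

text \<open>
  The edges outside a chosen graph impose the conditions \<open>x\<^sub>k = x\<^bsub>c i\<^esub>\<close>; a linear
  relation between these is a balanced weighting of the edges.
\<close>

lemma dim_direction_forest:
  fixes T :: "('n::finite \<times> 'd::finite) set"
  assumes "forest T" and rows: "\<And>i. \<exists>k. (i, k) \<in> T"
  shows "dim (direction T :: (real^'d) set) + card T = CARD('n) + CARD('d)"
proof -
  obtain c where c: "graph c \<subseteq> T" using rows by (rule obtain_graph)
  define E where "E = T - graph c"
  define e :: "'n \<times> 'd \<Rightarrow> real^'d"
    where "e = (\<lambda>(i, k). axis k 1 - axis (c i) 1)"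
  have indep: "u s = 0" if sum0: "(\<Sum>s\<in>E. u s *\<^sub>R e s) = 0" and s: "s \<in> E" for u s
  proof -
    define w where "w i k = (if (i, k) \<in> E then u (i, k) else 0)" for i k
    \<comment> \<open>The edge \<open>(i, c i)\<close> absorbs the weights in the row \<open>i\<close>; the column sums are the
      coordinates of the given linear relation.\<close>
    define b where "b i k = w i k - (if k = c i then \<Sum>j\<in>UNIV. w i j else 0)" for i k
    have "b i k = 0" for i k
    proof (rule forestD[OF \<open>forest T\<close>])
      show "b i k = 0" if "(i, k) \<notin> T" for i k
        using that c by (auto simp: b_def w_def E_def graph_subset_iff)
      show "(\<Sum>k\<in>UNIV. b i k) = 0" for i
        by (simp add: b_def sum_subtractf)
      fix k
      have "(\<Sum>s\<in>E. u s *\<^sub>R e s) = (\<Sum>s\<in>UNIV. (if s \<in> E then u s else 0) *\<^sub>R e s)"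
        by (rule sum.mono_neutral_cong_left) auto
      also have "\<dots> = (\<Sum>i\<in>UNIV. \<Sum>j\<in>UNIV. w i j *\<^sub>R e (i, j))"
        unfolding w_def sum.cartesian_product UNIV_Times_UNIV by (intro sum.cong) auto
      finally have "0 = (\<Sum>i\<in>UNIV. \<Sum>j\<in>UNIV. w i j *\<^sub>R e (i, j)) $ k"
        using sum0 by simp
      also have "\<dots> = (\<Sum>i\<in>UNIV. \<Sum>j\<in>UNIV. (if j = k then w i j else 0) - (if k = c i then w i j else 0))"
        by (auto simp: e_def axis_def intro!: sum.cong)
      also have "\<dots> = (\<Sum>i\<in>UNIV. b i k)"
        by (auto simp: b_def sum_subtractf intro!: sum.cong)
      finally show "(\<Sum>i\<in>UNIV. b i k) = 0" by simp
    qed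
    moreover obtain i k where ik: "s = (i, k)" by (cases s)
    then have "k \<noteq> c i" using s by (auto simp: E_def)
    ultimately have "w i k = 0" by (metis b_def diff_zero)
    then show ?thesis using s ik by (simp add: w_def)
  qed
  have inj: "inj_on e E"
  proof (rule inj_onI, rule ccontr)
    fix s t assume st: "s \<in> E" "t \<in> E" "e s = e t" "s \<noteq> t"
    let ?u = "\<lambda>r. (if r = s then 1 else 0) - (if r = t then 1 else 0 :: real)"
    have "(\<Sum>r\<in>E. ?u r *\<^sub>R e r) = (\<Sum>r\<in>E. if r = s then e r else 0) - (\<Sum>r\<in>E. if r = t then e r else 0)"
      unfolding sum_subtractf[symmetric] by (intro sum.cong) auto
    also have "\<dots> = 0" using st by simp
    finally have "?u s = 0" using indep[of ?u s] st(1) by blast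
    with st(4) show False by simp
  qed
  have "independent (e ` E)"
  proof (rule independent_if_scalars_zero)
    show "finite (e ` E)" by simp
    fix g x assume g: "(\<Sum>y\<in>e ` E. g y *\<^sub>R y) = 0" and "x \<in> e ` E"
    then obtain s where s: "s \<in> E" "x = e s" by blast
    have "(\<Sum>s\<in>E. g (e s) *\<^sub>R e s) = 0"
      using g by (simp add: sum.reindex[OF inj])
    then show "g x = 0" using indep[of "\<lambda>s. g (e s)"] s by blast
  qed
  then have "dim (span (e ` E)) = card E"
    by (simp add: dim_eq_card_independent card_image inj)
  moreover have "dim {y \<in> UNIV. \<forall>x\<in>span (e ` E). orthogonal x y} + dim (span (e ` E)) = dim (UNIV :: (real^'d) set)"
    by (intro dim_subspace_orthogonal_to_vectors) auto
  moreover have "{y \<in> UNIV. \<forall>x\<in>span (e ` E). orthogonal x y} = direction T"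
  proof -
    have orth: "orthogonal (e (i, k)) y \<longleftrightarrow> y $ k = y $ c i" for i k and y :: "real^'d"
      by (simp add: e_def orthogonal_def inner_diff_left inner_axis')
    have "y \<in> direction T" if "\<forall>x\<in>e ` E. orthogonal x y" for y
    proof -
      have "y $ k = y $ c i" if "(i, k) \<in> T" for i k
      proof (cases "k = c i")
        case False
        with that have "(i, k) \<in> E" by (simp add: E_def)
        then show ?thesis using orth \<open>\<forall>x\<in>e ` E. orthogonal x y\<close> by blast
      qed simp
      then have "y $ j = y $ k" if "(i, j) \<in> T" "(i, k) \<in> T" for i j k
        using that by simp
      then show ?thesis unfolding direction_def by blast
    qed
    moreover have "orthogonal x y" if y: "y \<in> direction T" and x: "x \<in> span (e ` E)" for x y
    proof -
      have "orthogonal y x" using x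
      proof (rule orthogonal_to_span)
        fix z assume "z \<in> e ` E"
        then obtain i k where ik: "(i, k) \<in> E" "z = e (i, k)" by auto
        then have "y $ k = y $ c i"
          using y c unfolding direction_def E_def graph_subset_iff by blast
        then show "orthogonal y z" using orth ik(2) orthogonal_commute by blast
      qed
      then show ?thesis by (simp add: orthogonal_commute)
    qed
    ultimately show ?thesis using span_superset by blast
  qed
  moreover have "card E = card T - CARD('n)"
    unfolding E_def by (simp add: card_Diff_subset[OF _ c])
  moreover have "CARD('n) \<le> card T"
    using card_mono[OF _ c] by simp
  ultimately show ?thesis by simp
qed

text \<open>
  Two different choices of one edge per row, in the same type and with equal column counts,
  differ by alternating cycles; so this says that all types are forests. In this form it
  concerns optimal assignments, which makes it detectable from the number of regions.
\<close>

definition generic :: "real^'d^'n \<Rightarrow> bool"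
  where "generic v \<longleftrightarrow> (\<forall>p f g. graph f \<subseteq> type_at v p \<longrightarrow> graph g \<subseteq> type_at v p \<longrightarrow>
    column_count (graph f) = column_count (graph (g :: 'n::finite \<Rightarrow> 'd::finite)) \<longrightarrow> f = g)"

text \<open>
  A minimal nonempty subset that is mapped into itself is mapped onto itself.
\<close>

lemma self_map_has_bijective_part:
  assumes "finite S" "S \<noteq> {}" "\<pi> ` S \<subseteq> S"
  obtains C where "C \<subseteq> S" "C \<noteq> {}" "bij_betw \<pi> C C"
proof -
  let ?F = "{C. C \<subseteq> S \<and> C \<noteq> {} \<and> \<pi> ` C \<subseteq> C}"
  have "finite ?F" "?F \<noteq> {}" using assms by auto
  then obtain C where C: "C \<in> ?F" and min: "\<And>B. B \<in> ?F \<Longrightarrow> B \<subseteq> C \<Longrightarrow> C = B"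
    using finite_has_minimal[of ?F] by (metis (no_types, lifting))
  have "\<pi> ` C \<in> ?F" using C by auto
  then have "\<pi> ` C = C" using min C by auto
  moreover have "finite C" using C assms(1) finite_subset by blast
  ultimately have "bij_betw \<pi> C C"
    by (simp add: bij_betw_def eq_card_imp_inj_on)
  then show thesis using that C by blast
qed

lemma exists_neg_of_sum_zero:
  fixes g :: "'a::finite \<Rightarrow> real"
  assumes "sum g UNIV = 0" "g a \<noteq> 0"
  shows "\<exists>x. g x < 0"
proof (rule ccontr)
  assume "\<not> ?thesis"
  then have "\<And>x. 0 \<le> g x" by (simp add: not_less)
  then have "\<forall>x\<in>UNIV. g x = 0"
    using assms(1) by (subst (asm) sum_nonneg_eq_0_iff) auto
  with assms(2) show False by blast
qed

lemma exists_pos_of_sum_zero: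
  fixes g :: "'a::finite \<Rightarrow> real"
  assumes "sum g UNIV = 0" "g a \<noteq> 0"
  shows "\<exists>x. 0 < g x"
  using exists_neg_of_sum_zero[of "\<lambda>x. - g x" a] assms by (simp add: sum_negf)

text \<open>
  In a balanced weighting step from a row along a positive edge to a column and on along a
  negative edge to a row. The rows that recur are permuted by these steps, so their positive
  edges and their negative edges are two different choices with equal column counts.
\<close>

lemma generic_imp_forest:
  fixes v :: "real^'d::finite^'n::finite"
  assumes "generic v"
  shows "forest (type_at v p)"
  unfolding forest_def
proof (intro allI impI, rule ccontr)
  fix w :: "'n \<Rightarrow> 'd \<Rightarrow> real" and i0 k0
  assume supp: "\<forall>i k. (i, k) \<notin> type_at v p \<longrightarrow> w i k = 0"
    and row: "\<forall>i. (\<Sum>k\<in>UNIV. w i k) = 0" and col: "\<forall>k. (\<Sum>i\<in>UNIV. w i k) = 0"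
    and nz: "w i0 k0 \<noteq> 0"
  define S where "S = {i. \<exists>k. w i k \<noteq> 0}"
  have "\<forall>i\<in>S. \<exists>k. 0 < w i k"
    using exists_pos_of_sum_zero row by (auto simp: S_def)
  then obtain f where f: "\<And>i. i \<in> S \<Longrightarrow> 0 < w i (f i)" by metis
  have "\<forall>i\<in>S. \<exists>h. w h (f i) < 0"
  proof
    fix i assume "i \<in> S"
    then have "w i (f i) \<noteq> 0" using f by force
    then show "\<exists>h. w h (f i) < 0"
      using exists_neg_of_sum_zero[of "\<lambda>h. w h (f i)" i] col by simp
  qed
  then obtain \<pi> where \<pi>: "\<And>i. i \<in> S \<Longrightarrow> w (\<pi> i) (f i) < 0" by metis
  have "\<pi> ` S \<subseteq> S"
  proof (clarify)
    fix i assume "i \<in> S"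
    then have "w (\<pi> i) (f i) \<noteq> 0" using \<pi> by force
    then show "\<pi> i \<in> S" by (auto simp: S_def)
  qed
  moreover have "S \<noteq> {}" using nz by (auto simp: S_def)
  ultimately obtain C where C: "C \<subseteq> S" "C \<noteq> {}" "bij_betw \<pi> C C"
    using self_map_has_bijective_part[of S \<pi>] by auto
  obtain c where c: "graph c \<subseteq> type_at v p"
    using type_at_row_nonempty by (rule obtain_graph)
  define F where "F i = (if i \<in> C then f i else c i)" for i
  define G where "G i = (if i \<in> C then f (the_inv_into C \<pi> i) else c i)" for i
  have inj: "inj_on \<pi> C" and img: "\<pi> ` C = C"
    using C(3) by (auto simp: bij_betw_def)
  have surj: "\<exists>h\<in>C. i = \<pi> h" if "i \<in> C" for i
  proof -
    have "i \<in> \<pi> ` C" using that by (simp only: img)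
    then show ?thesis by blast
  qed
  have closed: "\<pi> i \<in> C" if "i \<in> C" for i
    using imageI[OF that, of \<pi>] by (simp only: img)
  have G\<pi>: "G (\<pi> i) = f i" if "i \<in> C" for i
    using that inj closed by (simp add: G_def the_inv_into_f_f)
  have G_neg: "w i (G i) < 0" if "i \<in> C" for i
  proof -
    obtain h where "h \<in> C" "i = \<pi> h" using surj[OF \<open>i \<in> C\<close>] by blast
    then have "w (\<pi> h) (f h) < 0" "G (\<pi> h) = f h" using \<pi> C(1) G\<pi> by blast+
    then show ?thesis using \<open>i = \<pi> h\<close> by simp
  qed
  have "graph F \<subseteq> type_at v p"
    unfolding graph_subset_iff
  proof
    fix i show "(i, F i) \<in> type_at v p"
    proof (cases "i \<in> C")
      case True
      then have "w i (f i) \<noteq> 0" using f[of i] C(1) by auto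
      then show ?thesis using supp True by (auto simp: F_def)
    next
      case False
      then show ?thesis using c by (simp add: F_def graph_subset_iff)
    qed
  qed
  moreover have "graph G \<subseteq> type_at v p"
    unfolding graph_subset_iff
  proof
    fix i show "(i, G i) \<in> type_at v p"
    proof (cases "i \<in> C")
      case True
      then show ?thesis using supp[rule_format, of i "G i"] G_neg by fastforce
    next
      case False
      then show ?thesis using c by (simp add: G_def graph_subset_iff)
    qed
  qed
  moreover have "column_count (graph F) = column_count (graph G)"
  proof
    fix k
    have split: "{i. k = H i} = {i\<in>C. H i = k} \<union> {i. i \<notin> C \<and> H i = k}" for H :: "'n \<Rightarrow> 'd"
      by auto
    have disj: "card {i. k = H i} = card {i\<in>C. H i = k} + card {i. i \<notin> C \<and> H i = k}" for H :: "'n \<Rightarrow> 'd"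
      unfolding split by (rule card_Un_disjoint) auto
    have "bij_betw \<pi> {i\<in>C. F i = k} {i\<in>C. G i = k}"
      unfolding bij_betw_def
    proof
      show "inj_on \<pi> {i\<in>C. F i = k}" using inj by (auto simp: inj_on_def)
      show "\<pi> ` {i\<in>C. F i = k} = {i\<in>C. G i = k}"
      proof (intro equalityI subsetI)
        fix x assume "x \<in> \<pi> ` {i\<in>C. F i = k}"
        then obtain h where h: "h \<in> C" "F h = k" "x = \<pi> h" by blast
        then have "x \<in> C" using closed by simp
        then show "x \<in> {i\<in>C. G i = k}" using h G\<pi> by (simp add: F_def)
      next
        fix x assume x: "x \<in> {i\<in>C. G i = k}"
        then obtain h where "h \<in> C" "x = \<pi> h" using surj by blast
        moreover have "F h = k" using x G\<pi> \<open>h \<in> C\<close> \<open>x = \<pi> h\<close> by (simp add: F_def)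
        ultimately show "x \<in> \<pi> ` {i\<in>C. F i = k}" by blast
      qed
    qed
    then have "card {i\<in>C. F i = k} = card {i\<in>C. G i = k}" by (rule bij_betw_same_card)
    moreover have "{i. i \<notin> C \<and> F i = k} = {i. i \<notin> C \<and> G i = k}"
      by (auto simp: F_def G_def)
    ultimately show "column_count (graph F) k = column_count (graph G) k"
      by (simp add: column_count_def disj)
  qed
  ultimately have "F = G" using assms unfolding generic_def by blast
  moreover obtain i where "i \<in> C" using C(2) by blast
  ultimately show False
    using f[of i] G_neg[of i] C(1) by (auto simp: F_def fun_eq_iff dest!: spec[of _ i])
qed

lemma dim_direction_generic:
  fixes v :: "real^'d::finite^'n::finite"
  assumes "generic v"
  shows "dim (direction (type_at v p)) + card (type_at v p) = CARD('n) + CARD('d)"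
  using dim_direction_forest[OF generic_imp_forest[OF assms] type_at_row_nonempty] .

text \<open>
  Cells are invariant under translation by \<open>(1,\<dots>,1)\<close>, so their dimension upstairs is at least
  one; this bounds the number of edges as in a forest.
\<close>

lemma card_type_at_generic:
  fixes v :: "real^'d::finite^'n::finite"
  assumes "generic v"
  shows "card (type_at v p) < CARD('n) + CARD('d)"
  using dim_direction_generic[OF assms, of p] dim_direction_pos[of "type_at v p"] by simp

section \<open>Points of bounded coarse type\<close>

text \<open>
  Take the maximum of the witnesses. This produces points that are close to the supremum of a
  set closed under maxima in all coordinates at once.
\<close>

lemma finitely_many_lower_bounds:
  fixes Y :: "(real^'d::finite) set"
  assumes "Y \<noteq> {}" and max: "\<And>p q. p \<in> Y \<Longrightarrow> q \<in> Y \<Longrightarrow> (\<chi> l. max (p $ l) (q $ l)) \<in> Y"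
    and "finite H" "\<And>k. k \<in> H \<Longrightarrow> \<exists>q\<in>Y. b k \<le> q $ k"
  shows "\<exists>p\<in>Y. \<forall>k\<in>H. b k \<le> p $ k"
  using assms(3,4)
proof (induction H rule: finite_induct)
  case empty
  then show ?case using assms(1) by blast
next
  case (insert k H)
  then obtain p q where pq: "p \<in> Y" "\<And>l. l \<in> H \<Longrightarrow> b l \<le> p $ l" "q \<in> Y" "b k \<le> q $ k"
    by (metis insertCI)
  then have "\<forall>l\<in>insert k H. b l \<le> (\<chi> l. max (p $ l) (q $ l)) $ l"
    by (auto simp: le_max_iff_disj)
  then show ?case using max pq by blast
qed

text \<open>
  Fix a column \<open>k0\<close> with \<open>u k0 > 0\<close> and consider the points with \<open>p $ k0 = 0\<close> that obey
  the bound \<open>u\<close> in all other columns. This set is closed under maxima, and it is bounded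
  above, because otherwise some point would have all rows attain their minima in columns
  whose bounds add up to less than the number of rows. At its supremum every column other
  than \<open>k0\<close> exceeds its bound, and as a forest has few edges this forces column \<open>k0\<close> down
  to \<open>u k0\<close>. Points of the set close to the supremum then obey all bounds.
\<close>

lemma coarse_lower_set_nonempty_exact:
  fixes v :: "real^'d::finite^'n::finite"
  assumes gen: "generic v" and u: "(\<Sum>k\<in>UNIV. u k) = CARD('n)"
  shows "coarse_lower_set v u \<noteq> {}"
proof -
  have "\<exists>k0. 0 < u k0"
    using u by (metis finite less_irrefl neq0_conv sum.neutral zero_less_card_finite)
  then obtain k0 where k0: "0 < u k0" by blast
  have u_split: "u k0 + (\<Sum>k\<in>- {k0}. u k) = CARD('n)"
    using u sum.remove[of UNIV k0 u] by (simp add: Compl_eq_Diff_UNIV)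
  define Y where "Y = {p. p $ k0 = 0 \<and> (\<forall>k. k \<noteq> k0 \<longrightarrow> column_count (type_at v p) k \<le> u k)}"
  have max: "(\<chi> l. max (p $ l) (q $ l)) \<in> Y" if "p \<in> Y" "q \<in> Y" for p q
  proof -
    have "column_count (type_at v (\<chi> l. max (p $ l) (q $ l))) k \<le> u k" if "k \<noteq> k0" for k
    proof -
      have "column_count (type_at v p) k \<le> u k" "column_count (type_at v q) k \<le> u k"
        using \<open>p \<in> Y\<close> \<open>q \<in> Y\<close> that by (auto simp: Y_def)
      then show ?thesis
        using column_count_type_at_max[of v p 0 q k] by simp
    qed
    then show ?thesis using that by (simp add: Y_def)
  qed
  have v_bound: "\<bar>v $ i $ k\<bar> \<le> norm v" for i k
    by (rule order.trans[OF component_le_norm_cart Finite_Cartesian_Product.norm_nth_le])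
  have "(\<chi> l. if l = k0 then 0 else - (2 * norm v + 1)) \<in> Y" (is "?q \<in> Y")
  proof -
    have "(i, k) \<notin> type_at v ?q" if "k \<noteq> k0" for i k
      using that v_bound[of i k] v_bound[of i k0]
      by (auto simp: type_at_def not_le intro!: exI[of _ k0])
    then have "column_count (type_at v ?q) k = 0" if "k \<noteq> k0" for k
      using that by (simp add: column_count_def)
    then show ?thesis by (simp add: Y_def)
  qed
  then have Y: "Y \<noteq> {}" by blast
  define H where "H = {k. \<not> bdd_above ((\<lambda>p. p $ k) ` Y)}"
  have "k0 \<notin> H"
    by (auto simp: H_def Y_def bdd_above_def)
  have "H = {}"
  proof (rule ccontr)
    assume "H \<noteq> {}"
    then obtain h where h: "h \<in> H" by blast
    have "\<forall>k\<in>- H. \<exists>B. \<forall>p\<in>Y. p $ k \<le> B"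
      by (auto simp: H_def bdd_above_def)
    then obtain B where B: "\<And>k p. k \<notin> H \<Longrightarrow> p \<in> Y \<Longrightarrow> p $ k \<le> B k"
      by (metis ComplI)
    let ?m = "2 * norm v + 1 + (\<Sum>k\<in>UNIV. \<bar>B k\<bar>)"
    \<comment> \<open>So far above \<open>B\<close> that no row attains its minimum outside \<open>H\<close>.\<close>
    have "\<exists>p\<in>Y. \<forall>k\<in>H. ?m \<le> p $ k"
    proof (rule finitely_many_lower_bounds[OF Y max])
      fix k assume "k \<in> H"
      then show "\<exists>q\<in>Y. ?m \<le> q $ k"
        unfolding H_def bdd_above_def by (auto simp: not_le) (meson less_imp_le)
    qed simp_all
    then obtain p where p: "p \<in> Y" "\<And>k. k \<in> H \<Longrightarrow> ?m \<le> p $ k" by blast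
    have "k \<in> H" if "(i, k) \<in> type_at v p" for i k
    proof (rule ccontr)
      assume "k \<notin> H"
      then have "p $ k \<le> B k" using B p(1) by blast
      also have "\<dots> \<le> (\<Sum>k\<in>UNIV. \<bar>B k\<bar>)"
        using member_le_sum[of k UNIV "\<lambda>k. \<bar>B k\<bar>"] by simp
      finally have "p $ k + 2 * norm v + 1 \<le> p $ h" using p(2)[OF h] by linarith
      moreover have "v $ i $ k - p $ k \<le> v $ i $ h - p $ h"
        using that by (simp add: type_at_def)
      ultimately show False using v_bound[of i k] v_bound[of i h] by linarith
    qed
    then have zero: "column_count (type_at v p) k = 0" if "k \<notin> H" for k
      using that by (auto simp: column_count_def)
    have "CARD('n) \<le> (\<Sum>k\<in>UNIV. column_count (type_at v p) k)"
      using CARD_le_card_type_at sum_column_count by metis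
    also have "\<dots> = (\<Sum>k\<in>- {k0}. column_count (type_at v p) k)"
      using zero[OF \<open>k0 \<notin> H\<close>] by (intro sum.mono_neutral_right) auto
    also have "\<dots> \<le> (\<Sum>k\<in>- {k0}. u k)"
      using p(1) by (intro sum_mono) (auto simp: Y_def)
    finally show False using u_split k0 by linarith
  qed
  then have bdd: "bdd_above ((\<lambda>p. p $ k) ` Y)" for k
    by (auto simp: H_def)
  define s where "s = (\<chi> k. SUP p\<in>Y. p $ k)"
  have s_upper: "p $ k \<le> s $ k" if "p \<in> Y" for p k
    unfolding s_def using cSUP_upper[OF that bdd] by simp
  obtain r where r: "0 < r" "\<And>q. dist q s < r \<Longrightarrow> type_at v q \<subseteq> type_at v s"
    using eventually_type_at_subset[of v s] unfolding eventually_nhds_metric by blast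
  define \<delta> where "\<delta> = r / (2 * CARD('d))"
  have \<delta>: "0 < \<delta>" using r(1) by (simp add: \<delta>_def)
  have near: "type_at v q \<subseteq> type_at v s" if "\<And>k. \<bar>q $ k - s $ k\<bar> \<le> \<delta>" for q
  proof (rule r(2))
    have "dist q s \<le> (\<Sum>k\<in>UNIV. \<bar>(q - s) $ k\<bar>)"
      unfolding dist_norm by (rule norm_le_l1_cart)
    also have "\<dots> \<le> (\<Sum>k\<in>(UNIV :: 'd set). \<delta>)"
      using that by (intro sum_mono) simp
    also have "\<dots> < r" using r(1) by (simp add: \<delta>_def)
    finally show "dist q s < r" .
  qed
  have "\<exists>p\<in>Y. \<forall>k\<in>UNIV. s $ k - \<delta> \<le> p $ k"
  proof (rule finitely_many_lower_bounds[OF Y max])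
    fix k
    have "s $ k - \<delta> < (SUP p\<in>Y. p $ k)" using \<delta> by (simp add: s_def)
    then show "\<exists>q\<in>Y. s $ k - \<delta> \<le> q $ k"
      using less_cSUP_iff[OF Y bdd] by (meson less_imp_le)
  qed simp_all
  then obtain p where p: "p \<in> Y" "\<And>k. s $ k - \<delta> \<le> p $ k" by blast
  have "\<bar>p $ k - s $ k\<bar> \<le> \<delta>" for k
    using p s_upper[of p k] \<delta> by (simp add: abs_le_iff) (smt (verit))
  then have ps: "type_at v p \<subseteq> type_at v s" by (rule near)
  have full: "u k < column_count (type_at v s) k" if k: "k \<noteq> k0" for k
  proof (rule ccontr)
    assume "\<not> ?thesis"
    then have le: "column_count (type_at v s) k \<le> u k" by simp
    \<comment> \<open>Otherwise \<open>p\<close> could be raised above \<open>s\<close> in the coordinate \<open>k\<close> without leaving \<open>Y\<close>.\<close>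
    define q where "q = (\<chi> l. if l = k then s $ k + \<delta> else p $ l)"
    have "type_at v q \<subseteq> type_at v s"
    proof (rule near)
      fix l show "\<bar>q $ l - s $ l\<bar> \<le> \<delta>"
        using \<open>\<bar>p $ l - s $ l\<bar> \<le> \<delta>\<close> \<delta> by (simp add: q_def)
    qed
    then have "column_count (type_at v q) k \<le> u k"
      using le column_count_mono order.trans by metis
    moreover have "column_count (type_at v q) l \<le> column_count (type_at v p) l" if "l \<noteq> k" for l
      unfolding column_count_def
    proof (intro card_mono subsetI; clarsimp)
      fix i assume i: "(i, l) \<in> type_at v q"
      show "(i, l) \<in> type_at v p"
        unfolding type_at_def
      proof (clarsimp)
        fix j
        have "v $ i $ l - q $ l \<le> v $ i $ j - q $ j" using i by (simp add: type_at_def)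
        moreover have "p $ j \<le> q $ j" using s_upper[OF p(1), of k] \<delta> by (simp add: q_def)
        ultimately show "v $ i $ l - p $ l \<le> v $ i $ j - p $ j"
          using \<open>l \<noteq> k\<close> by (simp add: q_def split: if_splits)
      qed
    qed
    moreover have "column_count (type_at v p) l \<le> u l" if "l \<noteq> k0" for l
      using p(1) that by (simp add: Y_def)
    ultimately have "column_count (type_at v q) l \<le> u l" if "l \<noteq> k0" for l
      using that order.trans by (cases "l = k") blast+
    moreover have "q $ k0 = 0" using p(1) k by (simp add: Y_def q_def)
    ultimately have "q \<in> Y" by (simp add: Y_def)
    then show False using s_upper[of q k] \<delta> by (simp add: q_def)
  qed
  have "(\<Sum>k\<in>- {k0}. u k + 1) \<le> (\<Sum>k\<in>- {k0}. column_count (type_at v s) k)"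
    using full by (intro sum_mono) (simp add: Suc_le_eq)
  moreover have "(\<Sum>k\<in>- {k0}. u k + 1) = (\<Sum>k\<in>- {k0}. u k) + (CARD('d) - 1)"
    unfolding sum.distrib by (simp add: Compl_eq_Diff_UNIV)
  moreover have "column_count (type_at v s) k0 + (\<Sum>k\<in>- {k0}. column_count (type_at v s) k)
      = card (type_at v s)"
    using sum_column_count[of "type_at v s"] sum.remove[of UNIV k0 "column_count (type_at v s)"]
    by (simp add: Compl_eq_Diff_UNIV)
  moreover have "card (type_at v s) < CARD('n) + CARD('d)"
    by (rule card_type_at_generic) (rule gen)
  ultimately have "column_count (type_at v s) k0 \<le> u k0"
    using u_split by linarith
  then have "column_count (type_at v p) k0 \<le> u k0"
    using column_count_mono[OF ps] order.trans by metis
  then have "p \<in> coarse_lower_set v u"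
    using p(1) unfolding coarse_lower_set_def Y_def le_fun_def by auto
  then show ?thesis by blast
qed

lemma coarse_lower_set_nonempty_iff:
  fixes v :: "real^'d::finite^'n::finite"
  assumes gen: "generic v"
  shows "coarse_lower_set v u \<noteq> {} \<longleftrightarrow> CARD('n) \<le> (\<Sum>k\<in>UNIV. u k)"
proof
  assume "coarse_lower_set v u \<noteq> {}"
  then obtain p where "column_count (type_at v p) \<le> u"
    by (auto simp: coarse_lower_set_def)
  then have "(\<Sum>k\<in>UNIV. column_count (type_at v p) k) \<le> (\<Sum>k\<in>UNIV. u k)"
    by (intro sum_mono) (simp add: le_fun_def)
  then show "CARD('n) \<le> (\<Sum>k\<in>UNIV. u k)"
    using CARD_le_card_type_at[of v p] by (simp add: sum_column_count)
next
  assume "CARD('n) \<le> (\<Sum>k\<in>UNIV. u k)"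
  then obtain m where "(\<Sum>k\<in>UNIV. u k) = CARD('n) + m"
    by (metis le_Suc_ex)
  then show "coarse_lower_set v u \<noteq> {}"
  proof (induction m arbitrary: u)
    case 0
    then show ?case using coarse_lower_set_nonempty_exact[OF gen] by simp
  next
    case (Suc m)
    have "\<exists>k. 0 < u k"
      using Suc.prems by (metis add_is_0 finite neq0_conv old.nat.distinct(1) sum.neutral)
    then obtain k where k: "0 < u k" by blast
    let ?u = "u(k := u k - 1)"
    have "(\<Sum>l\<in>UNIV. ?u l) = CARD('n) + m"
      using Suc.prems k sum.remove[of UNIV k u] sum.remove[of UNIV k ?u] by simp
    then have "coarse_lower_set v ?u \<noteq> {}" by (rule Suc.IH)
    moreover have "?u \<le> u" by (simp add: le_fun_def)
    ultimately show ?case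
      unfolding coarse_lower_set_def using order.trans by blast
  qed
qed

section \<open>Regions and genericity\<close>

text \<open>
  The full-dimensional cells: in each row the minimum is attained exactly once.
\<close>

definition regions :: "real^'d^'n \<Rightarrow> ('n::finite \<Rightarrow> 'd::finite) set"
  where "regions v = {f. graph f \<in> range (type_at v)}"

lemma finite_functions_sum_eq: "finite {u :: 'd::finite \<Rightarrow> nat. (\<Sum>k\<in>UNIV. u k) = n}"
proof (rule finite_subset)
  show "{u :: 'd \<Rightarrow> nat. (\<Sum>k\<in>UNIV. u k) = n} \<subseteq> PiE UNIV (\<lambda>_. {..n})"
  proof
    fix u :: "'d \<Rightarrow> nat" assume "u \<in> {u. (\<Sum>k\<in>UNIV. u k) = n}"
    then have "u k \<le> n" for k
      using member_le_sum[of k UNIV u] by simp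
    then show "u \<in> PiE UNIV (\<lambda>_. {..n})" by auto
  qed
  show "finite (PiE (UNIV :: 'd set) (\<lambda>_. {..n}))"
    by (intro finite_PiE) auto
qed

lemma sum_column_count_graph:
  fixes f :: "'n::finite \<Rightarrow> 'd::finite"
  shows "(\<Sum>k\<in>UNIV. column_count (graph f) k) = CARD('n)"
  by (simp add: sum_column_count)

lemma sum_over_graph:
  fixes f :: "'n::finite \<Rightarrow> 'd::finite" and r :: "'d \<Rightarrow> real"
  shows "(\<Sum>i\<in>UNIV. r (f i)) = (\<Sum>k\<in>UNIV. real (column_count (graph f) k) * r k)"
proof -
  have "(\<Sum>i\<in>UNIV. r (f i)) = (\<Sum>i\<in>UNIV. \<Sum>k\<in>UNIV. if k = f i then r k else 0)"
    by simp
  also have "\<dots> = (\<Sum>k\<in>UNIV. \<Sum>i\<in>UNIV. if k = f i then r k else 0)"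
    by (rule sum.swap)
  also have "\<dots> = (\<Sum>k\<in>UNIV. \<Sum>i\<in>{i. k = f i}. r k)"
    by (intro sum.cong refl sum.mono_neutral_cong_right) auto
  also have "\<dots> = (\<Sum>k\<in>UNIV. real (column_count (graph f) k) * r k)"
    by (simp only: column_count_def mem_graph_iff sum_constant)
  finally show ?thesis .
qed

text \<open>
  A region with choice \<open>f\<close> certifies that \<open>f\<close> is the unique minimiser of the total weight
  \<open>\<Sum>i. v $ i $ f i\<close> for its column counts, the coordinates of its points being dual variables.
  A choice inside any type is a minimiser, too.
\<close>

lemma region_choice_unique:
  fixes v :: "real^'d::finite^'n::finite"
  assumes f: "f \<in> regions v" and g: "graph g \<subseteq> type_at v q"
    and counts: "column_count (graph f) = column_count (graph g)"
  shows "f = g"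
proof (rule ccontr)
  assume "f \<noteq> g"
  then obtain h where h: "f h \<noteq> g h" by auto
  obtain p where p: "type_at v p = graph f"
    using f by (auto simp: regions_def)
  have f_min: "v $ i $ f i - p $ f i \<le> v $ i $ j - p $ j" for i j
    using p[THEN equalityD2] by (auto simp: graph_subset_iff type_at_def)
  have strict: "v $ h $ f h - p $ f h < v $ h $ g h - p $ g h"
  proof -
    have "(h, g h) \<notin> type_at v p" "(h, f h) \<in> type_at v p" using h p by auto
    then show ?thesis using type_at_mem_iff f_min[of h "g h"] by (metis order_le_less)
  qed
  have same: "(\<Sum>i\<in>UNIV. r (f i)) = (\<Sum>i\<in>UNIV. r (g i))" for r :: "'d \<Rightarrow> real"
    by (simp add: sum_over_graph counts)
  have "(\<Sum>i\<in>UNIV. v $ i $ f i - p $ f i) < (\<Sum>i\<in>UNIV. v $ i $ g i - p $ g i)"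
    by (rule sum_strict_mono_ex1) (use f_min strict in auto)
  moreover have "(\<Sum>i\<in>UNIV. v $ i $ g i - q $ g i) \<le> (\<Sum>i\<in>UNIV. v $ i $ f i - q $ f i)"
    using g by (intro sum_mono) (auto simp: graph_subset_iff type_at_def)
  ultimately show False
    using same[of "($) p"] same[of "($) q"] by (simp add: sum_subtractf)
qed

lemma inj_on_column_count_regions: "inj_on (\<lambda>f. column_count (graph f)) (regions v)"
proof (rule inj_onI)
  fix f g assume fg: "f \<in> regions v" "g \<in> regions v"
    "column_count (graph f) = column_count (graph g)"
  obtain q where "graph g = type_at v q"
    using fg(2) unfolding regions_def by blast
  then have "graph g \<subseteq> type_at v q" by simp
  then show "f = g" using region_choice_unique[OF fg(1), of g q] fg(3) by simp
qed

text \<open>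
  A point of coarse type at most \<open>u\<close> has coarse type \<open>u\<close>, since every row contributes at least
  one edge; then every row contributes exactly one.
\<close>

lemma column_counts_regions_generic:
  fixes v :: "real^'d::finite^'n::finite"
  assumes "generic v" and u: "(\<Sum>k\<in>UNIV. u k) = CARD('n)"
  shows "\<exists>f\<in>regions v. column_count (graph f) = u"
proof -
  have "coarse_lower_set v u \<noteq> {}"
    using coarse_lower_set_nonempty_iff[OF assms(1), of u] u by simp
  then obtain p where p: "column_count (type_at v p) \<le> u"
    by (auto simp: coarse_lower_set_def)
  have "(\<Sum>k\<in>UNIV. column_count (type_at v p) k) \<le> (\<Sum>k\<in>UNIV. u k)"
    using p by (intro sum_mono) (simp add: le_fun_def)
  then have card: "card (type_at v p) = CARD('n)"
    using CARD_le_card_type_at[of v p] u by (simp add: sum_column_count)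
  obtain c where c: "graph c \<subseteq> type_at v p"
    using type_at_row_nonempty by (rule obtain_graph)
  then have eq: "graph c = type_at v p"
    using card by (intro card_subset_eq) auto
  have "column_count (graph c) k = u k" for k
    by (rule sum_mono_inv[of _ UNIV]) (use eq card p u in \<open>simp_all add: sum_column_count le_fun_def\<close>)
  then show ?thesis
    using eq by (intro bexI[of _ c]) (auto simp: regions_def)
qed

text \<open>
  Regions have different column counts, so there are at most as many as admissible counts,
  and equality means that every count occurs. If two choices inside a type have equal column
  counts, no region has these counts.
\<close>

lemma generic_iff_card_regions:
  fixes v :: "real^'d::finite^'n::finite"
  shows "generic v \<longleftrightarrow> card (regions v) = card {u :: 'd \<Rightarrow> nat. (\<Sum>k\<in>UNIV. u k) = CARD('n)}"
proof -
  let ?U = "{u :: 'd \<Rightarrow> nat. (\<Sum>k\<in>UNIV. u k) = CARD('n)}"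
  let ?c = "\<lambda>f :: 'n \<Rightarrow> 'd. column_count (graph f)"
  have sub: "?c ` regions v \<subseteq> ?U"
    by (auto simp: sum_column_count_graph)
  have card: "card (?c ` regions v) = card (regions v)"
    by (rule card_image) (rule inj_on_column_count_regions)
  have "generic v \<longleftrightarrow> ?c ` regions v = ?U"
  proof
    assume "generic v"
    then show "?c ` regions v = ?U"
      using column_counts_regions_generic sub by blast
  next
    assume onto: "?c ` regions v = ?U"
    show "generic v"
      unfolding generic_def
    proof (intro allI impI)
      fix p f g
      assume fg: "graph f \<subseteq> type_at v p" "graph g \<subseteq> type_at v p" "?c f = ?c g"
      have "?c f \<in> ?U" by (simp add: sum_column_count_graph)
      with onto obtain h where h: "h \<in> regions v" "?c h = ?c f" by (metis imageE)
      then show "f = g"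
        using region_choice_unique[OF h(1) fg(1)] region_choice_unique[OF h(1) fg(2)] fg(3) by simp
    qed
  qed
  then show ?thesis
    using card sub card_subset_eq[OF finite_functions_sum_eq sub] by metis
qed

lemma obtain_nat_enumeration:
  obtains e :: "'a::finite \<Rightarrow> nat" where "inj e"
  using finite_imp_inj_to_nat_seg[of "UNIV :: 'a set"] by auto

text \<open>
  Moving \<open>p\<close> a little in a direction with distinct coordinates breaks all ties.
\<close>

lemma exists_region_below:
  fixes v :: "real^'d::finite^'n::finite"
  shows "\<exists>f\<in>regions v. graph f \<subseteq> type_at v p"
proof -
  obtain e :: "'d \<Rightarrow> nat" where e: "inj e" by (rule obtain_nat_enumeration)
  define q where "q t = p + t *\<^sub>R (\<chi> k. real (e k))" for t
  have "(q \<longlongrightarrow> p + 0 *\<^sub>R (\<chi> k. real (e k))) (at_right 0)"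
    unfolding q_def by (intro tendsto_intros)
  then have "(q \<longlongrightarrow> p) (at_right 0)" by simp
  then have "\<forall>\<^sub>F t in at_right 0. type_at v (q t) \<subseteq> type_at v p"
    by (rule eventually_compose_filterlim[OF eventually_type_at_subset])
  then have "\<forall>\<^sub>F t in at_right 0. type_at v (q t) \<subseteq> type_at v p \<and> 0 < t"
    by (simp add: eventually_conj eventually_at_right_less)
  then obtain t where t: "type_at v (q t) \<subseteq> type_at v p" "0 < t"
    using eventually_happens'[OF trivial_limit_at_right_real] by blast
  obtain c where c: "graph c \<subseteq> type_at v (q t)"
    using type_at_row_nonempty by (rule obtain_graph)
  have "k = c i" if k: "(i, k) \<in> type_at v (q t)" for i k
  proof -
    have ci: "(i, c i) \<in> type_at v (q t)" using c by (simp add: graph_subset_iff)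
    have "v $ i $ k - q t $ k = v $ i $ c i - q t $ c i"
      using type_at_mem_iff[OF ci] k by blast
    moreover have "v $ i $ k - p $ k = v $ i $ c i - p $ c i"
      using type_at_mem_iff[of i "c i" v p k] ci k t(1) by blast
    moreover have "q t $ k = p $ k + t * real (e k)" "q t $ c i = p $ c i + t * real (e (c i))"
      by (simp_all add: q_def)
    ultimately have "t * real (e k) = t * real (e (c i))"
      by linarith
    then show ?thesis using t(2) e by (simp add: inj_eq)
  qed
  then have "type_at v (q t) = graph c"
    using c by auto
  then show ?thesis
    using t(1) by (intro bexI[of _ c]) (auto simp: regions_def)
qed

lemma not_generic_imp_equal_weights:
  fixes v :: "real^'d::finite^'n::finite"
  assumes "\<not> generic v"
  shows "\<exists>f g. f \<noteq> g \<and> (\<Sum>i\<in>UNIV. v $ i $ f i) = (\<Sum>i\<in>UNIV. v $ i $ g i)"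
proof -
  obtain p and f g :: "'n \<Rightarrow> 'd" where fg: "graph f \<subseteq> type_at v p" "graph g \<subseteq> type_at v p"
    and counts: "column_count (graph f) = column_count (graph g)" and "f \<noteq> g"
    using assms unfolding generic_def by blast
  have "v $ i $ f i - p $ f i = v $ i $ g i - p $ g i" for i
    using type_at_mem_iff[of i "g i" v p "f i"] fg by (simp add: graph_subset_iff)
  then have "(\<Sum>i\<in>UNIV. v $ i $ f i - p $ f i) = (\<Sum>i\<in>UNIV. v $ i $ g i - p $ g i)"
    by simp
  then have "(\<Sum>i\<in>UNIV. v $ i $ f i) = (\<Sum>i\<in>UNIV. v $ i $ g i)"
    using sum_over_graph[of "($) p" f] sum_over_graph[of "($) p" g] counts
    by (simp add: sum_subtractf)
  with \<open>f \<noteq> g\<close> show ?thesis by blast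
qed

text \<open>
  Distinct powers of two as entries: the sums are then binary expansions.
\<close>

lemma exists_distinct_weights:
  "\<exists>w :: real^'d::finite^'n::finite.
    \<forall>f g. (\<Sum>i\<in>UNIV. w $ i $ f i) = (\<Sum>i\<in>UNIV. w $ i $ g i) \<longrightarrow> f = g"
proof -
  obtain e :: "'n \<times> 'd \<Rightarrow> nat" where e: "inj e" by (rule obtain_nat_enumeration)
  define w :: "real^'d^'n" where "w = (\<chi> i k. 2 ^ e (i, k))"
  have weight: "(\<Sum>i\<in>UNIV. w $ i $ f i) = real (set_encode (e ` graph f))" for f
  proof -
    have "inj (\<lambda>i. e (i, f i))"
      using e by (auto simp: inj_def)
    moreover have "e ` graph f = range (\<lambda>i. e (i, f i))" by (auto simp: graph_def)
    ultimately show ?thesis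
      by (simp add: w_def set_encode_def sum.reindex)
  qed
  have "f = g" if "(\<Sum>i\<in>UNIV. w $ i $ f i) = (\<Sum>i\<in>UNIV. w $ i $ g i)" for f g
  proof -
    have "e ` graph f = e ` graph g"
      using that unfolding weight by (simp add: set_encode_eq)
    then show ?thesis using e by (simp add: inj_image_eq_iff)
  qed
  then show ?thesis by blast
qed

text \<open>
  On a line in this direction two choices get equal weight at no more than one parameter.
\<close>

lemma eventually_generic_perturbation:
  fixes v :: "real^'d::finite^'n::finite"
  obtains w where "\<forall>\<^sub>F t in at_right 0. generic (v + t *\<^sub>R w)"
proof -
  obtain w :: "real^'d^'n" where w: "\<And>f g. (\<Sum>i\<in>UNIV. w $ i $ f i) = (\<Sum>i\<in>UNIV. w $ i $ g i) \<Longrightarrow> f = g"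
    using exists_distinct_weights by blast
  \<comment> \<open>The value at the diagonal pairs, a division by zero, only adds one more excluded parameter.\<close>
  define bad where "bad = (\<lambda>(f, g). ((\<Sum>i\<in>UNIV. v $ i $ g i) - (\<Sum>i\<in>UNIV. v $ i $ f i)) /
      ((\<Sum>i\<in>UNIV. w $ i $ f i) - (\<Sum>i\<in>UNIV. w $ i $ g i)))"
  have "generic (v + t *\<^sub>R w)" if t: "t \<notin> range bad" for t
  proof (rule ccontr)
    assume "\<not> generic (v + t *\<^sub>R w)"
    then obtain f g where "f \<noteq> g"
      and eq: "(\<Sum>i\<in>UNIV. (v + t *\<^sub>R w) $ i $ f i) = (\<Sum>i\<in>UNIV. (v + t *\<^sub>R w) $ i $ g i)"
      using not_generic_imp_equal_weights by blast
    have "(\<Sum>i\<in>UNIV. v $ i $ f i) + t * (\<Sum>i\<in>UNIV. w $ i $ f i) =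
        (\<Sum>i\<in>UNIV. v $ i $ g i) + t * (\<Sum>i\<in>UNIV. w $ i $ g i)"
      using eq by (simp add: sum.distrib sum_distrib_left)
    moreover have "(\<Sum>i\<in>UNIV. w $ i $ f i) - (\<Sum>i\<in>UNIV. w $ i $ g i) \<noteq> 0"
      using w \<open>f \<noteq> g\<close> by auto
    ultimately have "t = bad (f, g)"
      by (simp add: bad_def nonzero_eq_divide_eq algebra_simps)
    with t show False by blast
  qed
  moreover have "\<forall>\<^sub>F t in at_right 0. t \<notin> range bad"
  proof -
    have "\<forall>\<^sub>F t in at_right 0. \<forall>b\<in>range bad. t \<noteq> b"
      by (intro eventually_ball_finite) (auto intro: eventually_neq_at_within)
    then show ?thesis by (rule eventually_mono) blast
  qed
  ultimately show thesis
    using that eventually_mono by (metis (mono_tags, lifting))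
qed

section \<open>Cells in the tropical torus\<close>

definition project :: "real^'d^'n \<Rightarrow> ('d::finite tropical_torus)^'n::finite"
  where "project v = (\<chi> i. torus_proj (v $ i))"

definition type_matrix :: "('n::finite \<times> 'd::finite) set \<Rightarrow> nat^'d^'n"
  where "type_matrix T = (\<chi> i k. if (i, k) \<in> T then 1 else 0)"

definition closed_cell :: "real^'d^'n \<Rightarrow> ('n::finite \<times> 'd::finite) set \<Rightarrow> 'd tropical_torus set"
  where "closed_cell v T = torus_proj ` {p. T \<subseteq> type_at v p}"

lemma obtain_torus_rep: obtains p where "P = torus_proj p"
  using tropical_torus.abs_induct[of "\<lambda>P. \<exists>p. P = torus_proj p" P] by blast

lemma torus_proj_eq_iff: "torus_proj p = torus_proj q \<longleftrightarrow> (\<exists>c. q = p + vec c)"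
  by (rule tropical_torus.abs_eq_iff)

lemma obtain_project: obtains v where "V = project v"
proof -
  have "\<forall>i. \<exists>p. V $ i = torus_proj p" by (metis obtain_torus_rep)
  then obtain r where "\<And>i. V $ i = torus_proj (r i)" by metis
  then have "V = project (\<chi> i. r i)" by (simp add: project_def vec_eq_iff)
  then show thesis by (rule that)
qed

lemma type_matrix_inject [simp]: "type_matrix S = type_matrix T \<longleftrightarrow> S = T"
proof
  assume "type_matrix S = type_matrix T"
  then have "type_matrix S $ i $ k = type_matrix T $ i $ k" for i k by simp
  then have "(i, k) \<in> S \<longleftrightarrow> (i, k) \<in> T" for i k
    by (simp add: type_matrix_def split: if_splits) (metis zero_neq_one)
  then show "S = T" by auto
qed simp

lemma fine_type_project: "fine_type (project v) (torus_proj p) = type_matrix (type_at v p)"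
  by (simp add: fine_type_def project_def type_matrix_def type_at_def torus_proj_in_max_sector)

lemma coarse_type_project:
  "coarse_type (project v) (torus_proj p) = (\<chi> k. column_count (type_at v p) k)"
  by (simp add: coarse_type_def fine_type_project type_matrix_def column_count_def sum.If_cases)

lemma type_at_add_vec: "type_at v (p + vec c) = type_at v p"
  by (simp add: type_at_def diff_diff_eq[symmetric])

lemma vimage_closed_cell: "torus_proj -` closed_cell v T = {p. T \<subseteq> type_at v p}"
proof (intro equalityI subsetI)
  fix q assume "q \<in> torus_proj -` closed_cell v T"
  then obtain p where p: "torus_proj p = torus_proj q" "T \<subseteq> type_at v p"
    by (auto simp: closed_cell_def)
  then obtain c where "q = p + vec c" using torus_proj_eq_iff by blast
  then show "q \<in> {p. T \<subseteq> type_at v p}" using p(2) by (simp add: type_at_add_vec)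
qed (simp add: closed_cell_def)

lemma fine_type_fibre: "{P. fine_type (project v) P = type_matrix T} = torus_proj ` open_cell v T"
proof (intro equalityI subsetI)
  fix P assume P: "P \<in> {P. fine_type (project v) P = type_matrix T}"
  obtain p where "P = torus_proj p" by (rule obtain_torus_rep)
  with P show "P \<in> torus_proj ` open_cell v T"
    by (auto simp: fine_type_project open_cell_def)
qed (auto simp: fine_type_project open_cell_def)

lemma closed_type_at_superset: "closed {p. T \<subseteq> type_at v p}"
proof -
  have "{p. T \<subseteq> type_at v p} = (\<Inter>s\<in>T. - {p. type_at v p \<subseteq> - {s}})"
    by blast
  moreover have "closed (\<Inter>s\<in>T. - {p. type_at v p \<subseteq> - {s}})"
    by (intro closed_INT ballI closed_Compl open_type_at_subset)
  ultimately show ?thesis by (simp only:)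
qed

lemma closure_open_cell:
  assumes "T \<in> range (type_at v)"
  shows "closure (open_cell v T) = {p. T \<subseteq> type_at v p}"
proof
  show "closure (open_cell v T) \<subseteq> {p. T \<subseteq> type_at v p}"
    by (rule closure_minimal) (auto simp: open_cell_def closed_type_at_superset)
  obtain p where p: "T = type_at v p" using assms by blast
  show "{p. T \<subseteq> type_at v p} \<subseteq> closure (open_cell v T)"
  proof
    fix q assume "q \<in> {p. T \<subseteq> type_at v p}"
    then have sub: "type_at v p \<subseteq> type_at v q" using p by simp
    define r where "r s = (1 - s) *\<^sub>R q + s *\<^sub>R p" for s
    have "(r \<longlongrightarrow> (1 - 0) *\<^sub>R q + 0 *\<^sub>R p) (at_right 0)"
      unfolding r_def by (intro tendsto_intros)
    then have "(r \<longlongrightarrow> q) (at_right 0)" by simp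
    moreover have "\<forall>\<^sub>F s in at_right 0. r s \<in> closure (open_cell v T)"
      using eventually_at_right_real[OF zero_less_one]
    proof eventually_elim
      case (elim s)
      then have "type_at v (r s) = T"
        unfolding r_def p by (intro type_at_segment sub) auto
      then have "r s \<in> open_cell v T" by (simp add: open_cell_def)
      then show ?case using closure_subset by blast
    qed
    ultimately show "q \<in> closure (open_cell v T)"
      by (intro Lim_in_closed_set[of _ r "at_right 0"]) auto
  qed
qed

lemma continuous_on_torus_proj: "continuous_on S torus_proj"
proof (rule continuous_on_subset[OF _ subset_UNIV])
  show "continuous_on UNIV torus_proj"
    by (simp add: continuous_on_open_vimage open_tropical_torus_def)
qed

lemma closed_closed_cell: "closed (closed_cell v T)"
proof -
  have "torus_proj -` (- closed_cell v T) = - {p. T \<subseteq> type_at v p}"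
    by (simp only: vimage_Compl vimage_closed_cell)
  then show ?thesis
    unfolding closed_def open_tropical_torus_def
    using closed_type_at_superset closed_def by metis
qed

lemma closure_fine_type_fibre:
  assumes "T \<in> range (type_at v)"
  shows "closure {P. fine_type (project v) P = type_matrix T} = closed_cell v T"
  unfolding fine_type_fibre
proof
  show "closure (torus_proj ` open_cell v T) \<subseteq> closed_cell v T"
    by (rule closure_minimal[OF _ closed_closed_cell]) (auto simp: closed_cell_def open_cell_def)
  have "torus_proj ` closure (open_cell v T) \<subseteq> closure (torus_proj ` open_cell v T)"
    by (intro image_closure_subset continuous_on_torus_proj closed_closure closure_subset)
  then show "closed_cell v T \<subseteq> closure (torus_proj ` open_cell v T)"
    by (simp add: closure_open_cell[OF assms] closed_cell_def)
qed

lemma cells_project: "cells (project v) = closed_cell v ` range (type_at v)"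
proof -
  have "\<exists>T\<in>range (type_at v). C = closed_cell v T" if "C \<in> cells (project v)" for C
  proof -
    obtain M P where C: "C = closure {Q. fine_type (project v) Q = M}" and P: "fine_type (project v) P = M"
      using \<open>C \<in> cells (project v)\<close> by (auto simp: cells_def)
    obtain p where "P = torus_proj p" by (rule obtain_torus_rep)
    then have "M = type_matrix (type_at v p)" using P fine_type_project by metis
    then show ?thesis using C closure_fine_type_fibre by blast
  qed
  moreover have "closed_cell v T \<in> cells (project v)" if "T \<in> range (type_at v)" for T
  proof -
    from that obtain p where "T = type_at v p" by blast
    then have "fine_type (project v) (torus_proj p) = type_matrix T"
      by (simp add: fine_type_project)
    then show ?thesis
      unfolding cells_def closure_fine_type_fibre[OF that, symmetric] by blast
  qed
  ultimately show ?thesis by blast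
qed

lemma closed_cell_subset_iff:
  assumes "S \<in> range (type_at v)"
  shows "closed_cell v S \<subseteq> closed_cell v T \<longleftrightarrow> T \<subseteq> S"
proof
  assume "closed_cell v S \<subseteq> closed_cell v T"
  then have "torus_proj -` closed_cell v S \<subseteq> torus_proj -` closed_cell v T"
    by (rule vimage_mono)
  then show "T \<subseteq> S" using assms unfolding vimage_closed_cell by blast
qed (auto simp: closed_cell_def)

lemma inj_on_closed_cell: "inj_on (closed_cell v) (range (type_at v))"
proof (rule inj_onI)
  fix S T assume "S \<in> range (type_at v)" "T \<in> range (type_at v)" "closed_cell v S = closed_cell v T"
  then show "S = T"
    using closed_cell_subset_iff[of S v T] closed_cell_subset_iff[of T v S] by simp
qed

lemma torus_dim_closed_cell:
  assumes "T \<in> range (type_at v)"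
  shows "torus_dim (closed_cell v T) = aff_dim (open_cell v T) - 1"
  unfolding torus_dim_def vimage_closed_cell closure_open_cell[OF assms, symmetric]
  by (simp add: closure_aff_dim)

lemma torus_rel_interior_closed_cell:
  assumes "T \<in> range (type_at v)"
  shows "torus_rel_interior (closed_cell v T) = torus_proj ` open_cell v T"
proof -
  have "rel_interior (closure (open_cell v T)) = open_cell v T"
    unfolding convex_rel_interior_closure[OF convex_open_cell]
    using rel_open_open_cell by (simp only: rel_open_def)
  then show ?thesis
    unfolding torus_rel_interior_def vimage_closed_cell closure_open_cell[OF assms, symmetric]
    by simp
qed

lemma cell_coarse_type_closed_cell:
  assumes "T \<in> range (type_at v)"
  shows "cell_coarse_type (project v) (closed_cell v T) = (\<chi> k. column_count T k)"
  unfolding cell_coarse_type_def torus_rel_interior_closed_cell[OF assms]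
proof (rule the_equality)
  show "\<forall>P\<in>torus_proj ` open_cell v T. coarse_type (project v) P = (\<chi> k. column_count T k)"
    by (auto simp: coarse_type_project open_cell_def)
  fix t assume t: "\<forall>P\<in>torus_proj ` open_cell v T. coarse_type (project v) P = t"
  obtain p where "p \<in> open_cell v T" using assms by (auto simp: open_cell_def)
  then show "t = (\<chi> k. column_count T k)"
    using t by (auto simp: coarse_type_project open_cell_def)
qed

text \<open>
  Defined through inclusions only, so that an isomorphism of face posets preserves them.
\<close>

definition maximal_cells :: "('d::finite tropical_torus)^'n::finite \<Rightarrow> 'd tropical_torus set set"
  where "maximal_cells V = {C \<in> cells V. \<forall>D\<in>cells V. C \<subseteq> D \<longrightarrow> D \<subseteq> C}"

text \<open>
  Larger cells have smaller types, and the smallest possible types are single choices.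
\<close>

lemma maximal_cells_project: "maximal_cells (project v) = (\<lambda>f. closed_cell v (graph f)) ` regions v"
proof (intro equalityI subsetI)
  fix C assume C: "C \<in> maximal_cells (project v)"
  then obtain p where p: "C = closed_cell v (type_at v p)"
    by (auto simp: maximal_cells_def cells_project)
  obtain f where f: "f \<in> regions v" "graph f \<subseteq> type_at v p"
    using exists_region_below by blast
  then have D: "graph f \<in> range (type_at v)" by (simp add: regions_def)
  have "C \<subseteq> closed_cell v (graph f)"
    unfolding p using f(2) by (subst closed_cell_subset_iff) auto
  moreover have "closed_cell v (graph f) \<in> cells (project v)"
    unfolding cells_project using D by (rule imageI)
  ultimately have "closed_cell v (graph f) \<subseteq> C"
    using C by (simp add: maximal_cells_def)
  with \<open>C \<subseteq> closed_cell v (graph f)\<close> f(1)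
  show "C \<in> (\<lambda>f. closed_cell v (graph f)) ` regions v" by blast
next
  fix C assume "C \<in> (\<lambda>f. closed_cell v (graph f)) ` regions v"
  then obtain f where f: "graph f \<in> range (type_at v)" "C = closed_cell v (graph f)"
    by (auto simp: regions_def)
  have "closed_cell v T \<subseteq> C" if T: "T \<in> range (type_at v)" and sub: "C \<subseteq> closed_cell v T" for T
  proof -
    have "T \<subseteq> graph f" using sub f closed_cell_subset_iff by blast
    have "(i, f i) \<in> T" for i
    proof -
      obtain k where k: "(i, k) \<in> T" using T type_at_row_nonempty by blast
      then have "k = f i" using \<open>T \<subseteq> graph f\<close> by auto
      with k show ?thesis by simp
    qed
    then have "graph f \<subseteq> T" by (simp add: graph_subset_iff)
    then show ?thesis unfolding f(2) using closed_cell_subset_iff[OF T] by simp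
  qed
  then show "C \<in> maximal_cells (project v)"
    using f by (auto simp: maximal_cells_def cells_project)
qed

lemma card_maximal_cells_project: "card (maximal_cells (project v)) = card (regions v)"
proof -
  have "inj_on (\<lambda>f. closed_cell v (graph f)) (regions v)"
  proof (rule inj_onI)
    fix f g assume "f \<in> regions v" "g \<in> regions v" "closed_cell v (graph f) = closed_cell v (graph g)"
    then have "graph f = graph g"
      using inj_on_closed_cell by (intro inj_onD[OF inj_on_closed_cell]) (auto simp: regions_def)
    then show "f = g" by simp
  qed
  then show ?thesis
    unfolding maximal_cells_project by (rule card_image)
qed

lemma card_maximal_cells_cong:
  assumes "same_combinatorial_type V W"
  shows "card (maximal_cells V) = card (maximal_cells W)"
proof -
  obtain f where f: "bij_betw f (cells V) (cells W)"
    and "\<forall>C\<in>cells V. \<forall>D\<in>cells V. C \<subseteq> D \<longleftrightarrow> f C \<subseteq> f D"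
    using assms unfolding same_combinatorial_type_def by (elim exE conjE)
  then have ord: "C \<subseteq> D \<longleftrightarrow> f C \<subseteq> f D" if "C \<in> cells V" "D \<in> cells V" for C D
    using that by simp
  have inj: "inj_on f (cells V)" and onto: "cells W = f ` cells V"
    using f by (auto simp: bij_betw_def)
  have "f ` maximal_cells V = maximal_cells W"
  proof (intro equalityI subsetI)
    fix E assume "E \<in> f ` maximal_cells V"
    then obtain C where C: "C \<in> cells V" "E = f C" "\<And>D. D \<in> cells V \<Longrightarrow> C \<subseteq> D \<Longrightarrow> D \<subseteq> C"
      by (auto simp: maximal_cells_def)
    have "f D \<subseteq> f C" if "D \<in> cells V" "f C \<subseteq> f D" for D
      using that C(1,3) ord[OF C(1) that(1)] ord[OF that(1) C(1)] by simp
    then show "E \<in> maximal_cells W"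
      using C(1,2) by (simp add: maximal_cells_def onto)
  next
    fix E assume E: "E \<in> maximal_cells W"
    then obtain C where C: "C \<in> cells V" "E = f C"
      unfolding maximal_cells_def onto by blast
    have "D \<subseteq> C" if "D \<in> cells V" "C \<subseteq> D" for D
    proof -
      have "f D \<subseteq> E"
        using E that ord[OF C(1) that(1)] C(2) by (simp add: maximal_cells_def onto)
      then show ?thesis using ord[OF that(1) C(1)] C(2) by simp
    qed
    then have "C \<in> maximal_cells V"
      using C(1) by (simp add: maximal_cells_def)
    then show "E \<in> f ` maximal_cells V" using C(2) by blast
  qed
  moreover have "inj_on f (maximal_cells V)"
    using inj by (rule inj_on_subset) (auto simp: maximal_cells_def)
  ultimately show ?thesis by (metis card_image)
qed

text \<open>
  Arbitrarily close to any arrangement there is one that satisfies \<^const>\<open>generic\<close>, and among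
  all arrangements the ones that do are exactly those with the most regions. The number of
  regions is the number of maximal cells, which the combinatorial type determines.
\<close>

lemma sufficiently_generic_imp_generic:
  assumes "sufficiently_generic (project v)"
  shows "generic v"
proof -
  obtain w where w: "\<forall>\<^sub>F t in at_right 0. generic (v + t *\<^sub>R w)"
    by (rule eventually_generic_perturbation)
  have "((\<lambda>t. project (v + t *\<^sub>R w)) \<longlongrightarrow> project v) (at_right 0)"
  proof (rule vec_tendstoI)
    fix i
    have "((\<lambda>t. v $ i + t *\<^sub>R w $ i) \<longlongrightarrow> v $ i + 0 *\<^sub>R w $ i) (at_right 0)"
      by (intro tendsto_intros)
    then have "((\<lambda>t. torus_proj (v $ i + t *\<^sub>R w $ i)) \<longlongrightarrow> torus_proj (v $ i)) (at_right 0)"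
      using continuous_on_torus_proj[of UNIV]
      by (intro continuous_on_tendsto_compose[of UNIV torus_proj]) auto
    then show "((\<lambda>t. project (v + t *\<^sub>R w) $ i) \<longlongrightarrow> project v $ i) (at_right 0)"
      by (simp add: project_def)
  qed
  then have "\<forall>\<^sub>F t in at_right 0. same_combinatorial_type (project v) (project (v + t *\<^sub>R w))"
    using assms unfolding sufficiently_generic_def by (rule eventually_compose_filterlim[rotated])
  with w have "\<forall>\<^sub>F t in at_right 0. generic (v + t *\<^sub>R w) \<and>
      same_combinatorial_type (project v) (project (v + t *\<^sub>R w))"
    by (rule eventually_conj)
  then obtain t where t: "generic (v + t *\<^sub>R w)"
    "same_combinatorial_type (project v) (project (v + t *\<^sub>R w))"
    using eventually_happens'[OF trivial_limit_at_right_real] by blast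
  from card_maximal_cells_cong[OF t(2)] have "card (regions v) = card (regions (v + t *\<^sub>R w))"
    by (simp only: card_maximal_cells_project)
  with t(1) show ?thesis by (simp only: generic_iff_card_regions)
qed

section \<open>Counting cells by coarse type\<close>

definition type_number :: "real^'d^'n \<Rightarrow> ('d::finite \<Rightarrow> nat) \<Rightarrow> nat"
  where "type_number v u = card {T :: ('n::finite \<times> 'd) set. T \<in> range (type_at v) \<and> column_count T = u}"

lemma aff_dim_open_cell_generic:
  fixes v :: "real^'d::finite^'n::finite"
  assumes "generic v" "T \<in> range (type_at v)"
  shows "aff_dim (open_cell v T) = int (CARD('n) + CARD('d)) - int (\<Sum>k\<in>UNIV. column_count T k)"
proof -
  obtain p where p: "T = type_at v p" using assms(2) by blast
  show ?thesis
    using dim_direction_generic[OF assms(1), of p]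
    unfolding p aff_dim_open_cell sum_column_count by linarith
qed

lemma finite_functions_le: "finite {w :: 'd::finite \<Rightarrow> nat. w \<le> u}"
proof (rule finite_subset)
  show "{w. w \<le> u} \<subseteq> PiE UNIV (\<lambda>k. {..u k})"
    by (auto simp: le_fun_def)
  show "finite (PiE (UNIV :: 'd set) (\<lambda>k. {..u k}))"
    by (intro finite_PiE) auto
qed

text \<open>
  For a forest the dimension of a cell is a function of its coarse type, so the alternating sum
  over cells becomes a signed sum over coarse types.
\<close>

lemma sum_type_number_generic:
  fixes v :: "real^'d::finite^'n::finite" and u :: "'d \<Rightarrow> nat"
  assumes "generic v"
  shows "(\<Sum>w | w \<le> u. int (type_number v w) * (-1) ^ nat (int (CARD('n) + CARD('d)) - int (\<Sum>k\<in>UNIV. w k)))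
    = (if CARD('n) \<le> (\<Sum>k\<in>UNIV. u k) then (-1) ^ CARD('d) else 0)"
proof -
  let ?J = "{T. T \<in> range (type_at v) \<and> column_count T \<le> u}"
  let ?s = "\<lambda>w::'d \<Rightarrow> nat. (-1) ^ nat (int (CARD('n) + CARD('d)) - int (\<Sum>k\<in>UNIV. w k)) :: int"
  have euler: "euler (open_cell v T) = ?s (column_count T)" if "T \<in> range (type_at v)" for T
  proof -
    have "open_cell v T \<noteq> {}" using that by (auto simp: open_cell_def)
    then show ?thesis
      by (simp add: euler_def aff_dim_open_cell_generic[OF assms that])
  qed
  have "(\<Sum>T\<in>?J. euler (open_cell v T)) = (\<Sum>T\<in>?J. ?s (column_count T))"
    using euler by (intro sum.cong) auto
  also have "\<dots> = (\<Sum>w | w \<le> u. \<Sum>T | T \<in> ?J \<and> column_count T = w. ?s (column_count T))"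
    by (rule sum.group[symmetric]) (auto simp: finite_functions_le)
  also have "\<dots> = (\<Sum>w | w \<le> u. int (type_number v w) * ?s w)"
  proof (rule sum.cong)
    fix w assume "w \<in> {w. w \<le> u}"
    then have set: "{T. T \<in> ?J \<and> column_count T = w} = {T. T \<in> range (type_at v) \<and> column_count T = w}"
      by auto
    have "(\<Sum>T | T \<in> ?J \<and> column_count T = w. ?s (column_count T)) =
        (\<Sum>T | T \<in> range (type_at v) \<and> column_count T = w. ?s w)"
      unfolding set by (rule sum.cong) auto
    then show "(\<Sum>T | T \<in> ?J \<and> column_count T = w. ?s (column_count T)) = int (type_number v w) * ?s w"
      by (simp add: type_number_def)
  qed simp
  finally have "(\<Sum>w | w \<le> u. int (type_number v w) * ?s w) =
      (if coarse_lower_set v u = {} then 0 else (-1) ^ CARD('d))"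
    by (simp only: euler_sum_coarse_lower_set)
  also have "\<dots> = (if CARD('n) \<le> (\<Sum>k\<in>UNIV. u k) then (-1) ^ CARD('d) else 0)"
    using coarse_lower_set_nonempty_iff[OF assms, of u] by auto
  finally show ?thesis .
qed

text \<open>
  Both families of numbers have the same partial sums below every \<open>u\<close>, and the summands
  below \<open>u\<close> determine the one at \<open>u\<close>.
\<close>

lemma type_number_generic_eq:
  fixes v w :: "real^'d::finite^'n::finite"
  assumes "generic v" "generic w"
  shows "type_number v u = type_number w u"
proof (induction "\<Sum>k\<in>UNIV. u k" arbitrary: u rule: less_induct)
  case less
  let ?s = "\<lambda>t::'d \<Rightarrow> nat. (-1) ^ nat (int (CARD('n) + CARD('d)) - int (\<Sum>k\<in>UNIV. t k)) :: int"
  let ?below = "\<lambda>v :: real^'d^'n. \<Sum>t\<in>{t. t \<le> u} - {u}. int (type_number v t) * ?s t"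
  have split: "(\<Sum>t | t \<le> u. int (type_number v t) * ?s t) = int (type_number v u) * ?s u + ?below v"
    for v :: "real^'d^'n"
    by (rule sum.remove) (auto simp: finite_functions_le)
  have "type_number v t = type_number w t" if t: "t \<le> u" "t \<noteq> u" for t
  proof (rule less)
    obtain k where "t k \<noteq> u k" using t(2) by (auto simp: fun_eq_iff)
    then have "t k < u k" using t(1) by (simp add: le_fun_def order_less_le)
    then show "(\<Sum>k\<in>UNIV. t k) < (\<Sum>k\<in>UNIV. u k)"
      using t(1) by (intro sum_strict_mono_ex1) (auto simp: le_fun_def)
  qed
  then have "?below v = ?below w" by (intro sum.cong) auto
  moreover have "int (type_number v u) * ?s u + ?below v = int (type_number w u) * ?s u + ?below w"
    unfolding split[symmetric] sum_type_number_generic[OF assms(1)] sum_type_number_generic[OF assms(2)] ..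
  ultimately show ?case by simp
qed

text \<open>
  All cells of a given coarse type have the same dimension. A forest on the
  rows and columns has as many edges as vertices, less the number of its components, and the
  components number one more than the dimension of the cell in the torus.
\<close>

lemma count_coarse_types_of_dim:
  fixes v :: "real^'d::finite^'n::finite"
  assumes "generic v"
  shows "count (coarse_types_of_dim (project v) i) t =
    (if (\<Sum>k\<in>UNIV. t $ k) + i + 1 = CARD('n) + CARD('d) then type_number v (($) t) else 0)"
proof -
  let ?V = "project v"
  let ?S = "{T. T \<in> range (type_at v) \<and> torus_dim (closed_cell v T) = int i \<and> column_count T = ($) t}"
  have col: "(\<chi> k. column_count T k) = t \<longleftrightarrow> column_count T = ($) t" for T :: "('n \<times> 'd) set"
    by (auto simp: vec_eq_iff fun_eq_iff)
  have "{C \<in> cells ?V. torus_dim C = int i \<and> cell_coarse_type ?V C = t} = closed_cell v ` ?S"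
  proof (intro equalityI subsetI)
    fix C assume C: "C \<in> {C \<in> cells ?V. torus_dim C = int i \<and> cell_coarse_type ?V C = t}"
    then obtain T where T: "T \<in> range (type_at v)" "C = closed_cell v T"
      unfolding cells_project by blast
    with C have "T \<in> ?S" by (simp add: cell_coarse_type_closed_cell col)
    with T(2) show "C \<in> closed_cell v ` ?S" by (rule rev_image_eqI[rotated])
  next
    fix C assume "C \<in> closed_cell v ` ?S"
    then obtain T where "T \<in> ?S" "C = closed_cell v T" by blast
    then show "C \<in> {C \<in> cells ?V. torus_dim C = int i \<and> cell_coarse_type ?V C = t}"
      by (simp add: cells_project cell_coarse_type_closed_cell col)
  qed
  then have "card {C \<in> cells ?V. torus_dim C = int i \<and> cell_coarse_type ?V C = t} = card ?S"
    by (metis (no_types, lifting) card_image inj_on_closed_cell inj_on_subset mem_Collect_eq subsetI)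
  moreover have "count (coarse_types_of_dim ?V i) t =
      card {C \<in> cells ?V. torus_dim C = int i \<and> cell_coarse_type ?V C = t}"
    unfolding coarse_types_of_dim_def count_image_mset'
    using finite_cells[of ?V] by (simp add: conj_commute eq_commute conj_ac)
  moreover have "torus_dim (closed_cell v T) = int i \<longleftrightarrow> (\<Sum>k\<in>UNIV. t $ k) + i + 1 = CARD('n) + CARD('d)"
    if "T \<in> range (type_at v)" "column_count T = ($) t" for T
    using torus_dim_closed_cell[OF that(1)] aff_dim_open_cell_generic[OF assms that(1)] that(2)
    by (auto simp del: of_nat_sum)
  then have "?S = (if (\<Sum>k\<in>UNIV. t $ k) + i + 1 = CARD('n) + CARD('d)
      then {T. T \<in> range (type_at v) \<and> column_count T = ($) t} else {})"
    by auto
  ultimately show ?thesis by (simp add: type_number_def)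
qed

theorem corollary6p2:
  fixes V W :: "('d::finite tropical_torus) ^ 'n::finite" and i :: nat
  assumes "sufficiently_generic V" and "sufficiently_generic W"
    and "i \<le> CARD('d) - 1"
  shows "coarse_types_of_dim V i = coarse_types_of_dim W i"
proof -
  obtain v where v: "V = project v" by (rule obtain_project)
  obtain w where w: "W = project w" by (rule obtain_project)
  have gen: "generic v" "generic w"
    using assms(1,2) unfolding v w by (auto intro: sufficiently_generic_imp_generic)
  then show ?thesis
    unfolding v w
    by (intro multiset_eqI) (simp add: count_coarse_types_of_dim type_number_generic_eq[OF gen])
qed

end
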